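(* Let $d \geq 1$. For every symmetric positive definite matrix $G \in \mathbb{R}^{d \times d}$ with $G_{ii} = 1$ for $i = 1, \dots, d$, we have \[ \Psi(G) + \frac{4}{\pi}\, t(G) \;\geq\; \left(2 + \frac{4}{\pi}\right) d. \] Equality holds if and only if $G$ is the identity matrix.
   Context: For a symmetric positive definite $d \times d$ matrix $G$ with unit diagonal entries, define the probability density on $\mathbb{R}^d$ \[ f_G(x) = \frac{\sqrt{\det G}}{(2\pi)^{d/2}} \exp\left(-\tfrac12 \langle Gx, x\rangle\right) \] (so $G$ is the inverse of the covariance matrix). Let $\mathbb{R}_+^d = (0,\infty)^d$ and, for $i \in \{1,\dots,d\}$, let \[ U_i = \{x \in \mathbb{R}^d : x_j > 0 \text{ for all } j \in \{1,\dots,d\} \setminus \{i\}\}. \] Let $\mathbf{1} \in \mathbb{R}^d$ be the vector with all coordinates equal to one. Define \[ \alpha(G) = \int_{\mathbb{R}_+^d} f_G(x)\,\mathrm{d}x, \qquad \beta_i(G) = \int_{U_i} f_G(x)\,\mathrm{d}x, \] \[ \Psi(G) = \frac{\sum_{i=1}^d \beta_i(G)}{\alpha(G)}, \qquad t(G) = \langle G^{-1}\mathbf{1}, \mathbf{1}\rangle. \] For $d = 1$, $U_1 = \mathbb{R}$ and $\beta_1(G) = 1$. *)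

theory Defs
  imports "HOL-Analysis.Analysis"
begin

definition sym_pos_def :: "real ^ 'n ^ 'n \<Rightarrow> bool" where
  "sym_pos_def G \<longleftrightarrow> transpose G = G \<and> (\<forall>x. x \<noteq> 0 \<longrightarrow> 0 < (G *v x) \<bullet> x)"

text \<open>The centred Gaussian density whose \<^emph>\<open>inverse\<close> covariance matrix is \<open>G\<close>.\<close>

definition gauss_density :: "real ^ 'n ^ 'n \<Rightarrow> real ^ 'n \<Rightarrow> real" where
  "gauss_density G x =
     sqrt (det G) / (2 * pi) powr (real CARD('n) / 2) * exp (- (1 / 2) * ((G *v x) \<bullet> x))"

definition pos_orthant :: "(real ^ 'n) set" where
  "pos_orthant = {x. \<forall>j. 0 < x $ j}"

definition pos_except :: "'n \<Rightarrow> (real ^ 'n) set" where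
  "pos_except i = {x. \<forall>j. j \<noteq> i \<longrightarrow> 0 < x $ j}"

definition alpha :: "real ^ 'n ^ 'n \<Rightarrow> real" where
  "alpha G = set_lebesgue_integral lborel pos_orthant (gauss_density G)"

definition beta :: "'n \<Rightarrow> real ^ 'n ^ 'n \<Rightarrow> real" where
  "beta i G = set_lebesgue_integral lborel (pos_except i) (gauss_density G)"

definition Psi :: "real ^ 'n ^ 'n \<Rightarrow> real" where
  "Psi G = (\<Sum>i\<in>UNIV. beta i G) / alpha G"

text \<open>Here \<open>1 :: real ^ 'n\<close> is the vector all of whose coordinates are one.\<close>

definition tval :: "real ^ 'n ^ 'n \<Rightarrow> real" where
  "tval G = (matrix_inv G *v 1) \<bullet> 1"

end

theory Submission
  imports Defs "HOL-Probability.Distributions"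
begin

text \<open>
Let \<open>Q\<close> be the Gaussian law with density \<open>f\<^sub>G\<close> conditioned on the positive orthant, let
\<open>\<mu>\<^sub>i\<close> and \<open>b\<^sub>i\<close> be the means of \<open>x\<^sub>i\<close> and of \<open>(G x)\<^sub>i\<close> under \<open>Q\<close>, and let
\<open>k = sqrt (2 / pi)\<close>.  By linearity \<open>b = G \<mu>\<close>; moreover \<open>b\<^sub>i\<close> is the density of \<open>x\<^sub>i\<close> at zero.
Since the diagonal of \<open>G\<close> is one, \<open>x\<^sub>i\<close> given the other coordinates is, before
conditioning on its sign, normal with variance one and mean \<open>- m\<^sub>i\<close>, where
\<open>m\<^sub>i = (G x)\<^sub>i - x\<^sub>i\<close> does not involve \<open>x\<^sub>i\<close>.  Integrating along lines in direction
\<open>i\<close> therefore reduces statements about a coordinate to statements about the normal tail function of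
one variable.  Four facts combine to the theorem.

\<^item> \<open>\<beta>\<^sub>i / \<alpha> = (2 / k) b\<^sub>i + \<delta>\<^sub>i\<close> with \<open>\<delta>\<^sub>i \<ge> 0\<close>, where \<open>\<delta>\<^sub>i\<close> is an integral of
  \<open>1 - exp (- m\<^sub>i\<^sup>2 / 2)\<close> (\<open>integral_pos_except_gauss_weight\<close>).

\<^item> \<open>b\<^sub>i \<ge> k + k\<^sup>2 (b\<^sub>i - \<mu>\<^sub>i)\<close>, the average of a tangent inequality for the inverse Mills ratio
  (\<open>inverse_mills_ratio_tangent\<close>, \<open>orthant_integral_combination_nonneg\<close>).

\<^item> \<open>\<mu>\<^sub>i b\<^sub>i \<le> 1\<close> (\<open>orthant_mean_times_boundary_density_le\<close>).  The marginal laws of \<open>Q\<close> are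
  log-concave by the Prekopa-Leindler inequality, and among log-concave laws on the half-line with a
  given density at zero the exponential law has the largest mean.

\<^item> \<open>t(G) \<ge> 2 \<langle>1, v\<rangle> - \<langle>G v, v\<rangle>\<close> for every \<open>v\<close> (\<open>tval_variational\<close>), used with
  \<open>v = \<mu> / k\<close>, for which \<open>G v = b / k\<close>.

Put \<open>y\<^sub>i = b\<^sub>i / k\<close> and \<open>z\<^sub>i = \<mu>\<^sub>i / k\<close>.  Since \<open>4 / pi = 2 k\<^sup>2\<close>, the left-hand side of
the theorem is at least the sum of \<open>\<delta>\<^sub>i + 2 y\<^sub>i + 2 k\<^sup>2 (2 z\<^sub>i - z\<^sub>i y\<^sub>i)\<close> over \<open>i\<close>, and each of
these terms is at least \<open>\<delta>\<^sub>i + 2 + 2 k\<^sup>2\<close> by an elementary inequality in \<open>y\<^sub>i\<close> and \<open>z\<^sub>i\<close>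
(\<open>coordinate_inequality\<close>).  Equality forces all \<open>\<delta>\<^sub>i\<close> to vanish, hence all \<open>m\<^sub>i\<close>, hence the
off-diagonal entries of \<open>G\<close>.  For the identity, conversely, \<open>m\<^sub>i = 0\<close> and
\<open>b\<^sub>i = \<mu>\<^sub>i = k\<close>, so that \<open>\<beta>\<^sub>i / \<alpha> = 2\<close>.
\<close>

section \<open>The Brunn-Minkowski inequality on the line\<close>

text \<open>
A set of reals is, up to at most one point (its maximum), the increasing union of countably many
of its initial parts cut off at points of the set itself.  Cutting at points of \<open>A\<close> replaces the
usual passage to compact sets, which contain their extreme points, in the proof of the
Brunn-Minkowski inequality.
\<close>

lemma emeasure_le_if_initial_parts_le:
  fixes A :: "real set"
  assumes A[measurable]: "A \<in> sets borel" and "A \<noteq> {}"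
    and le: "\<And>a. a \<in> A \<Longrightarrow> emeasure lborel (A \<inter> {..<a}) + d \<le> c"
  shows "emeasure lborel A + d \<le> c"
proof -
  have "\<exists>(x :: nat \<Rightarrow> real) p. incseq x \<and> (\<forall>n. \<exists>a\<in>A. x n \<le> a) \<and> A \<subseteq> (\<Union>n. {..<x n}) \<union> {p}"
  proof (cases "bdd_above A")
    case True
    define x where "x n = Sup A - 1 / real (Suc n)" for n
    have "incseq x"
      unfolding x_def incseq_def by (auto intro!: divide_left_mono)
    moreover have "\<exists>a\<in>A. x n \<le> a" for n
      using less_cSup_iff[OF \<open>A \<noteq> {}\<close> True, of "x n"] by (auto simp: x_def intro: less_imp_le)
    moreover have "a \<in> (\<Union>n. {..<x n}) \<union> {Sup A}" if "a \<in> A" for a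
    proof (cases "a = Sup A")
      case False
      then have "a < Sup A" using cSup_upper[OF \<open>a \<in> A\<close> True] by simp
      then obtain n where "1 / real (Suc n) < Sup A - a"
        using reals_Archimedean[of "Sup A - a"] by (auto simp: inverse_eq_divide)
      then have "a < x n" by (simp add: x_def)
      then show ?thesis by auto
    qed simp
    ultimately show ?thesis by (intro exI[of _ x] exI[of _ "Sup A"]) auto
  next
    case False
    have "incseq real" by (simp add: incseq_def)
    moreover have "\<exists>a\<in>A. real n \<le> a" for n
      using False unfolding bdd_above_def by (meson linorder_linear)
    moreover have "A \<subseteq> (\<Union>n. {..<real n})"
      using reals_Archimedean2 by blast
    ultimately show ?thesis by (intro exI[of _ real] exI[of _ 0]) auto
  qed
  then obtain x :: "nat \<Rightarrow> real" and p where x: "incseq x" "\<And>n. \<exists>a\<in>A. x n \<le> a"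
    "A \<subseteq> (\<Union>n. {..<x n}) \<union> {p}" by blast
  have "emeasure lborel A \<le> emeasure lborel ((\<Union>n. A \<inter> {..<x n}) \<union> {p})"
    using x(3) by (intro emeasure_mono) auto
  also have "\<dots> \<le> emeasure lborel (\<Union>n. A \<inter> {..<x n}) + emeasure lborel {p}"
    by (intro emeasure_subadditive) auto
  also have "\<dots> = emeasure lborel (\<Union>n. A \<inter> {..<x n})" by simp
  also have "\<dots> = (SUP n. emeasure lborel (A \<inter> {..<x n}))"
    using x(1) by (intro SUP_emeasure_incseq[symmetric]) (auto simp: incseq_def intro: less_le_trans)
  finally have "emeasure lborel A + d \<le> (SUP n. emeasure lborel (A \<inter> {..<x n})) + d"
    by (rule add_right_mono)
  also have "\<dots> = (SUP n. emeasure lborel (A \<inter> {..<x n}) + d)"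
    by (rule ennreal_SUP_add_left[symmetric]) simp
  also have "\<dots> \<le> c"
  proof (rule SUP_least)
    fix n
    obtain a where a: "a \<in> A" "x n \<le> a" using x(2) by blast
    have "emeasure lborel (A \<inter> {..<x n}) \<le> emeasure lborel (A \<inter> {..<a})"
      using a by (intro emeasure_mono) auto
    then show "emeasure lborel (A \<inter> {..<x n}) + d \<le> c"
      using le[OF a(1)] add_right_mono order_trans by blast
  qed
  finally show ?thesis .
qed

lemma emeasure_lborel_real_affine:
  fixes A :: "real set"
  assumes [measurable]: "A \<in> sets borel" and "c \<noteq> 0"
  shows "emeasure lborel A = ennreal \<bar>c\<bar> * emeasure lborel ((\<lambda>x. t + c * x) -` A)"
proof -
  have "(\<lambda>x. t + c * x) -` A \<inter> space borel \<in> sets borel"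
    by (rule measurable_sets[of _ borel borel]) auto
  then have m: "(\<lambda>x. t + c * x) -` A \<in> sets borel" by simp
  have "emeasure lborel A = (\<integral>\<^sup>+x. indicator A x \<partial>lborel)" by simp
  also have "\<dots> = \<bar>c\<bar> * (\<integral>\<^sup>+x. indicator A (t + c * x) \<partial>lborel)"
    by (rule nn_integral_real_affine) (use assms in auto)
  also have "(\<integral>\<^sup>+x. indicator A (t + c * x) \<partial>lborel) = (\<integral>\<^sup>+x. indicator ((\<lambda>x. t + c * x) -` A) x \<partial>lborel)"
    by (intro nn_integral_cong) (auto split: split_indicator)
  finally show ?thesis using m by simp
qed

text \<open>
Fix \<open>a\<close> in \<open>A\<close> and \<open>b\<close> in \<open>B\<close>.  The midpoints of \<open>b\<close> with the part of \<open>A\<close> below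
\<open>a\<close> lie in \<open>C\<close> to the left of \<open>(a + b) / 2\<close>, and the midpoints of \<open>a\<close> with the part of
\<open>B\<close> above \<open>b\<close> lie in \<open>C\<close> to the right of it.  These are disjoint half-size copies of the two
parts, and the parts exhaust \<open>A\<close> and \<open>B\<close> as \<open>a\<close> increases and \<open>b\<close> decreases.
\<close>

lemma brunn_minkowski_midpoint_real:
  fixes A B C :: "real set"
  assumes [measurable]: "A \<in> sets borel" "B \<in> sets borel" "C \<in> sets borel"
    and "A \<noteq> {}" "B \<noteq> {}"
    and mid: "\<And>a b. a \<in> A \<Longrightarrow> b \<in> B \<Longrightarrow> (a + b) / 2 \<in> C"
  shows "emeasure lborel A + emeasure lborel B \<le> 2 * emeasure lborel C"
proof -
  have *: "emeasure lborel (A \<inter> {..<a}) + emeasure lborel (B \<inter> {b<..}) \<le> 2 * emeasure lborel C"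
    if "a \<in> A" "b \<in> B" for a b
  proof -
    let ?q = "(a + b) / 2"
    have "emeasure lborel (A \<inter> {..<a}) = 2 * emeasure lborel ((\<lambda>x. - b + 2 * x) -` (A \<inter> {..<a}))"
      using emeasure_lborel_real_affine[of "A \<inter> {..<a}" 2 "- b"] by simp
    also have "\<dots> \<le> 2 * emeasure lborel (C \<inter> {..<?q})"
      using mid[OF _ \<open>b \<in> B\<close>] by (intro mult_left_mono emeasure_mono) (fastforce simp: field_simps)+
    finally have 1: "emeasure lborel (A \<inter> {..<a}) \<le> 2 * emeasure lborel (C \<inter> {..<?q})" .
    have "emeasure lborel (B \<inter> {b<..}) = 2 * emeasure lborel ((\<lambda>x. - a + 2 * x) -` (B \<inter> {b<..}))"
      using emeasure_lborel_real_affine[of "B \<inter> {b<..}" 2 "- a"] by simp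
    also have "\<dots> \<le> 2 * emeasure lborel (C \<inter> {?q<..})"
      using mid[OF \<open>a \<in> A\<close>] by (intro mult_left_mono emeasure_mono) (fastforce simp: field_simps)+
    finally have 2: "emeasure lborel (B \<inter> {b<..}) \<le> 2 * emeasure lborel (C \<inter> {?q<..})" .
    have "emeasure lborel (C \<inter> {..<?q}) + emeasure lborel (C \<inter> {?q<..})
        = emeasure lborel ((C \<inter> {..<?q}) \<union> (C \<inter> {?q<..}))"
      by (intro plus_emeasure) auto
    also have "\<dots> \<le> emeasure lborel C" by (intro emeasure_mono) auto
    finally have "2 * emeasure lborel (C \<inter> {..<?q}) + 2 * emeasure lborel (C \<inter> {?q<..}) \<le> 2 * emeasure lborel C"
      unfolding distrib_left[symmetric] by (rule mult_left_mono) simp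
    then show ?thesis using add_mono[OF 1 2] by (rule order_trans[rotated])
  qed
  have **: "emeasure lborel A + emeasure lborel (B \<inter> {b<..}) \<le> 2 * emeasure lborel C" if "b \<in> B" for b
    by (rule emeasure_le_if_initial_parts_le[OF assms(1,4) *[OF _ that]])
  \<comment> \<open>Exhausting \<open>B\<close> from above is exhausting its reflection from below.\<close>
  let ?B' = "(\<lambda>x. 0 + (-1) * x) -` B"
  have B': "?B' \<in> sets borel"
    using measurable_sets[of "\<lambda>x. 0 + (-1) * x" borel borel B] by simp
  have B: "emeasure lborel B = emeasure lborel ?B'"
    using emeasure_lborel_real_affine[of B "-1" 0] by simp
  have "emeasure lborel ?B' + emeasure lborel A \<le> 2 * emeasure lborel C"
  proof (rule emeasure_le_if_initial_parts_le[OF B'])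
    obtain b where "b \<in> B" using \<open>B \<noteq> {}\<close> by blast
    then have "- b \<in> ?B'" by simp
    then show "?B' \<noteq> {}" by blast
  next
    fix a assume a: "a \<in> ?B'"
    have "emeasure lborel (B \<inter> {-a<..}) = emeasure lborel ((\<lambda>x. 0 + (-1) * x) -` (B \<inter> {-a<..}))"
      using emeasure_lborel_real_affine[of "B \<inter> {-a<..}" "-1" 0] by simp
    also have "(\<lambda>x. 0 + (-1) * x) -` (B \<inter> {-a<..}) = ?B' \<inter> {..<a}" by auto
    finally show "emeasure lborel (?B' \<inter> {..<a}) + emeasure lborel A \<le> 2 * emeasure lborel C"
      using **[of "-a"] a by (simp add: add.commute)
  qed
  then show ?thesis unfolding B by (simp add: add.commute)
qed

lemma emeasure_lborel_greaterThan_0: "emeasure lborel {0::real<..} = \<infinity>"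
proof -
  have "ennreal (real n) \<le> emeasure lborel {0::real<..}" for n
  proof -
    have "emeasure lborel {0::real<..real n} \<le> emeasure lborel {0::real<..}"
      by (intro emeasure_mono) auto
    then show ?thesis by simp
  qed
  then show ?thesis
    by (metis ennreal_Ex_less_of_nat ennreal_of_nat_eq_real_of_nat infinity_ennreal_def leD less_top)
qed

text \<open>
The scale \<open>a\<close> serves to normalise functions with different suprema to a common range of levels.
\<close>

lemma nn_integral_layer_cake:
  fixes f :: "real \<Rightarrow> ennreal" and a :: real
  assumes [measurable]: "f \<in> borel_measurable borel" and "0 < a"
  shows "(\<integral>\<^sup>+x. f x \<partial>lborel)
    = ennreal a * (\<integral>\<^sup>+t. indicator {0<..} t * emeasure lborel {x. ennreal (a * t) < f x} \<partial>lborel)"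
proof -
  have fx: "f x = (\<integral>\<^sup>+t. indicator {t. 0 < t \<and> ennreal t < f x} t \<partial>lborel)" for x
  proof (cases "f x")
    case (real r)
    then have "{t. 0 < t \<and> ennreal t < f x} = {0<..<r}" by (auto simp: ennreal_less_iff)
    then show ?thesis using real by simp
  next
    case top
    then have "{t. 0 < t \<and> ennreal t < f x} = {0<..}" by auto
    then show ?thesis using top emeasure_lborel_greaterThan_0 by simp
  qed
  have "(\<integral>\<^sup>+x. f x \<partial>lborel) = (\<integral>\<^sup>+x. (\<integral>\<^sup>+t. indicator {t. 0 < t \<and> ennreal t < f x} t \<partial>lborel) \<partial>lborel)"
    using fx by simp
  also have "\<dots> = (\<integral>\<^sup>+x. (\<integral>\<^sup>+t. indicator {(x, t). 0 < t \<and> ennreal t < f x} (x, t) \<partial>lborel) \<partial>lborel)"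
    by (simp add: indicator_def)
  also have "\<dots> = (\<integral>\<^sup>+t. (\<integral>\<^sup>+x. indicator {(x, t). 0 < t \<and> ennreal t < f x} (x, t) \<partial>lborel) \<partial>lborel)"
    by (rule lborel_pair.Fubini'[symmetric]) (simp add: split_beta')
  also have "\<dots> = (\<integral>\<^sup>+t. indicator {0<..} t * emeasure lborel {x. ennreal t < f x} \<partial>lborel)"
  proof (intro nn_integral_cong)
    fix t :: real
    have "(\<integral>\<^sup>+x. indicator {(x, t). 0 < t \<and> ennreal t < f x} (x, t) \<partial>lborel)
      = (\<integral>\<^sup>+x. indicator {0<..} t * indicator {x. ennreal t < f x} x \<partial>lborel)"
      by (intro nn_integral_cong) (auto split: split_indicator)
    also have "\<dots> = indicator {0<..} t * emeasure lborel {x. ennreal t < f x}"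
      by (simp add: nn_integral_cmult)
    finally show "(\<integral>\<^sup>+x. indicator {(x, t). 0 < t \<and> ennreal t < f x} (x, t) \<partial>lborel)
      = indicator {0<..} t * emeasure lborel {x. ennreal t < f x}" .
  qed
  also have "\<dots> = \<bar>a\<bar> * (\<integral>\<^sup>+t. indicator {0<..} (0 + a * t) * emeasure lborel {x. ennreal (0 + a * t) < f x} \<partial>lborel)"
    by (rule nn_integral_real_affine) (use \<open>0 < a\<close> in auto)
  also have "(\<integral>\<^sup>+t. indicator {0<..} (0 + a * t) * emeasure lborel {x. ennreal (0 + a * t) < f x} \<partial>lborel)
     = (\<integral>\<^sup>+t. indicator {0<..} t * emeasure lborel {x. ennreal (a * t) < f x} \<partial>lborel)"
    using \<open>0 < a\<close> by (intro nn_integral_cong) (auto split: split_indicator simp: zero_less_mult_iff)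
  finally show ?thesis using \<open>0 < a\<close> by simp
qed

section \<open>The Prekopa-Leindler inequality for midpoints\<close>

lemma ennreal_arith_geo_mean_square:
  fixes x y z :: ennreal
  assumes "x + y \<le> 2 * z"
  shows "x * y \<le> z\<^sup>2"
proof (cases "z = \<infinity>")
  case False
  then obtain c where c: "z = ennreal c" "0 \<le> c" by (cases z) auto
  have "x + y < \<infinity>"
    using assms c by (metis ennreal_mult_less_top ennreal_less_top ennreal_numeral infinity_ennreal_def leD not_less_iff_gr_or_eq order_le_less_trans top.not_eq_extremum)
  then obtain a b where ab: "x = ennreal a" "0 \<le> a" "y = ennreal b" "0 \<le> b"
    by (cases x; cases y) auto
  have "ennreal (a + b) \<le> ennreal (2 * c)"
    using assms ab c by (simp add: ennreal_plus ennreal_mult)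
  then have "a + b \<le> 2 * c" using c by simp
  then have "(a + b)\<^sup>2 \<le> (2 * c)\<^sup>2" using ab by (intro power_mono) auto
  then have "a * b \<le> c\<^sup>2"
    using zero_le_power2[of "a - b"] by (simp add: power2_eq_square algebra_simps)
  then show ?thesis using ab c by (simp add: ennreal_mult[symmetric] ennreal_power)
qed simp

text \<open>
Rescaled by their suprema \<open>a\<close> and \<open>c\<close>, the two functions have non-empty superlevel sets for
exactly the same levels \<open>t < 1\<close>.  The hypothesis then places the midpoints of \<open>{f > a t}\<close>
and \<open>{g > c t}\<close> in \<open>{h > sqrt (a c) t}\<close>, so the one-dimensional Brunn-Minkowski inequality
compares the layers, and the arithmetic-geometric mean inequality turns the sum of the two integrals
into their product.
\<close>

lemma prekopa_leindler_midpoint_real_bounded: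
  fixes f g h :: "real \<Rightarrow> ennreal"
  assumes [measurable]: "f \<in> borel_measurable borel" "g \<in> borel_measurable borel"
      "h \<in> borel_measurable borel"
    and bf: "\<And>x. f x \<le> ennreal M" and bg: "\<And>x. g x \<le> ennreal M"
    and mid: "\<And>x y. f x * g y \<le> (h ((x + y) / 2))\<^sup>2"
  shows "(\<integral>\<^sup>+x. f x \<partial>lborel) * (\<integral>\<^sup>+x. g x \<partial>lborel) \<le> (\<integral>\<^sup>+x. h x \<partial>lborel)\<^sup>2"
proof -
  have "(SUP x. f x) \<le> ennreal M" "(SUP x. g x) \<le> ennreal M"
    using bf bg by (auto intro: SUP_least)
  then obtain a c where a: "(SUP x. f x) = ennreal a" "0 \<le> a" and c: "(SUP x. g x) = ennreal c" "0 \<le> c"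
    by (metis ennreal_cases ennreal_neq_top neq_top_trans)
  have fa: "f x \<le> ennreal a" for x using a(1) by (metis SUP_upper UNIV_I)
  have gc: "g x \<le> ennreal c" for x using c(1) by (metis SUP_upper UNIV_I)
  show ?thesis
  proof (cases "a = 0 \<or> c = 0")
    case True
    then have "(\<forall>x. f x = 0) \<or> (\<forall>x. g x = 0)" using fa gc by auto
    then show ?thesis by auto
  next
    case False
    then have ac: "0 < a" "0 < c" using a c by auto
    define r where "r = sqrt (a * c)"
    have r: "0 < r" "r * r = a * c" using ac by (auto simp: r_def)
    let ?F = "\<lambda>t. emeasure lborel {x. ennreal (a * t) < f x}"
    let ?G = "\<lambda>t. emeasure lborel {x. ennreal (c * t) < g x}"
    let ?H = "\<lambda>t. emeasure lborel {x. ennreal (r * t) < h x}"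
    let ?I = "\<lambda>\<phi>. \<integral>\<^sup>+t. indicator {0<..<1::real} t * \<phi> t \<partial>lborel"
    have cut: "(\<integral>\<^sup>+t. indicator {0<..} t * emeasure lborel {x. ennreal (b * t) < u x} \<partial>lborel)
        = ?I (\<lambda>t. emeasure lborel {x. ennreal (b * t) < u x})"
      if "\<And>x. u x \<le> ennreal b" "0 < b" for b :: real and u :: "real \<Rightarrow> ennreal"
    proof (intro nn_integral_cong)
      fix t :: real
      have "{x. ennreal (b * t) < u x} = {}" if "1 \<le> t"
      proof -
        have "ennreal b \<le> ennreal (b * t)" using \<open>0 < b\<close> \<open>1 \<le> t\<close> by (intro ennreal_leI) simp
        then have "u x \<le> ennreal (b * t)" for x
          by (rule order_trans[OF \<open>\<And>x. u x \<le> ennreal b\<close>])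
        then show ?thesis by (simp add: not_less)
      qed
      then show "indicator {0<..} t * emeasure lborel {x. ennreal (b * t) < u x}
          = indicator {0<..<1} t * emeasure lborel {x. ennreal (b * t) < u x}"
        by (cases "1 \<le> t") (auto split: split_indicator)
    qed
    have F: "(\<integral>\<^sup>+x. f x \<partial>lborel) = ennreal a * ?I ?F"
      using nn_integral_layer_cake[of f a] cut[of f a] fa ac by simp
    have G: "(\<integral>\<^sup>+x. g x \<partial>lborel) = ennreal c * ?I ?G"
      using nn_integral_layer_cake[of g c] cut[of g c] gc ac by simp
    have "(\<integral>\<^sup>+x. h x \<partial>lborel) = ennreal r * (\<integral>\<^sup>+t. indicator {0<..} t * ?H t \<partial>lborel)"
      using nn_integral_layer_cake[of h r] r by simp
    moreover have "?I ?H \<le> (\<integral>\<^sup>+t. indicator {0<..} t * ?H t \<partial>lborel)"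
      by (intro nn_integral_mono) (auto split: split_indicator)
    ultimately have H: "ennreal r * ?I ?H \<le> (\<integral>\<^sup>+x. h x \<partial>lborel)"
      by (simp add: mult_left_mono)
    have level: "indicator {0<..<1} t * ?F t + indicator {0<..<1} t * ?G t \<le> 2 * (indicator {0<..<1} t * ?H t)"
      for t :: real
    proof (cases "t \<in> {0<..<1}")
      case True
      then have "a * t < a" "c * t < c" using ac by auto
      then have "ennreal (a * t) < (SUP x. f x)" "ennreal (c * t) < (SUP x. g x)"
        unfolding a(1) c(1) using ac True by (auto intro!: ennreal_lessI)
      then have ne: "{x. ennreal (a * t) < f x} \<noteq> {}" "{x. ennreal (c * t) < g x} \<noteq> {}"
        by (auto simp: less_SUP_iff)
      have "?F t + ?G t \<le> 2 * ?H t"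
      proof (rule brunn_minkowski_midpoint_real[OF _ _ _ ne])
        fix x y assume "x \<in> {x. ennreal (a * t) < f x}" "y \<in> {x. ennreal (c * t) < g x}"
        then have "ennreal (a * t) * ennreal (c * t) < f x * g y"
          using fa[of x] gc[of y] ac True
          by (cases "f x"; cases "g y") (auto simp: ennreal_mult[symmetric] ennreal_less_iff top_unique intro!: mult_strict_mono
              intro: le_less_trans[OF mult_nonneg_nonneg[of a t]])
        also have "\<dots> \<le> (h ((x + y) / 2))\<^sup>2" by (rule mid)
        also have "ennreal (a * t) * ennreal (c * t) = (ennreal (r * t))\<^sup>2"
          using ac r True by (simp add: ennreal_mult[symmetric] power2_eq_square algebra_simps)
        finally have "ennreal (r * t) < h ((x + y) / 2)"
          by (metis leD le_less_linear power_mono zero_le)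
        then show "(x + y) / 2 \<in> {x. ennreal (r * t) < h x}" by simp
      qed auto
      then show ?thesis using True by simp
    qed simp
    have "?I ?F + ?I ?G = (\<integral>\<^sup>+t. indicator {0<..<1} t * ?F t + indicator {0<..<1} t * ?G t \<partial>lborel)"
      by (intro nn_integral_add[symmetric]) auto
    also have "\<dots> \<le> (\<integral>\<^sup>+t. 2 * (indicator {0<..<1} t * ?H t) \<partial>lborel)"
      by (intro nn_integral_mono level)
    also have "\<dots> = 2 * ?I ?H" by (intro nn_integral_cmult) auto
    finally have "?I ?F * ?I ?G \<le> (?I ?H)\<^sup>2" by (rule ennreal_arith_geo_mean_square)
    then have "ennreal (a * c) * (?I ?F * ?I ?G) \<le> ennreal (r * r) * (?I ?H)\<^sup>2"
      unfolding r(2) by (rule mult_left_mono) simp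
    also have "\<dots> = (ennreal r * ?I ?H)\<^sup>2"
      using \<open>0 < r\<close> by (simp add: ennreal_mult power2_eq_square ac_simps)
    also have "\<dots> \<le> (\<integral>\<^sup>+x. h x \<partial>lborel)\<^sup>2" by (intro power_mono H) simp
    finally show ?thesis unfolding F G using ac by (simp add: ennreal_mult ac_simps)
  qed
qed

lemma nn_integral_eq_SUP_truncations:
  fixes f :: "'a \<Rightarrow> ennreal"
  assumes [measurable]: "f \<in> borel_measurable M"
  shows "(\<integral>\<^sup>+x. f x \<partial>M) = (SUP n. \<integral>\<^sup>+x. min (f x) (of_nat n) \<partial>M)"
proof -
  have "(SUP n. min (f x) (of_nat n)) = f x" for x
  proof (cases "f x")
    case (real r)
    obtain n where "r \<le> real n" using real_arch_simple by blast
    then have "f x \<le> of_nat n" using real by (simp add: ennreal_of_nat_eq_real_of_nat ennreal_leI)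
    then show ?thesis by (intro antisym SUP_least SUP_upper2[of n]) auto
  next
    case top
    then show ?thesis by (simp add: ennreal_SUP_of_nat_eq_top)
  qed
  then have "(\<integral>\<^sup>+x. f x \<partial>M) = (\<integral>\<^sup>+x. (SUP n. min (f x) (of_nat n)) \<partial>M)" by simp
  also have "\<dots> = (SUP n. \<integral>\<^sup>+x. min (f x) (of_nat n) \<partial>M)"
    by (intro nn_integral_monotone_convergence_SUP)
       (auto simp: incseq_def le_fun_def min_le_iff_disj of_nat_mono intro: order_trans)
  finally show ?thesis .
qed

text \<open>
Truncation keeps the hypothesis, so boundedness can be dropped by monotone convergence.
\<close>

lemma prekopa_leindler_midpoint_real:
  fixes f g h :: "real \<Rightarrow> ennreal"
  assumes [measurable]: "f \<in> borel_measurable borel" "g \<in> borel_measurable borel"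
      "h \<in> borel_measurable borel"
    and mid: "\<And>x y. f x * g y \<le> (h ((x + y) / 2))\<^sup>2"
  shows "(\<integral>\<^sup>+x. f x \<partial>lborel) * (\<integral>\<^sup>+x. g x \<partial>lborel) \<le> (\<integral>\<^sup>+x. h x \<partial>lborel)\<^sup>2"
proof -
  have *: "(\<integral>\<^sup>+x. min (f x) (of_nat m) \<partial>lborel) * (\<integral>\<^sup>+x. min (g x) (of_nat n) \<partial>lborel)
      \<le> (\<integral>\<^sup>+x. h x \<partial>lborel)\<^sup>2" for m n :: nat
  proof (rule prekopa_leindler_midpoint_real_bounded[where M = "real (max m n)"])
    fix x y
    have "min (f x) (of_nat m) * min (g y) (of_nat n) \<le> f x * g y" by (intro mult_mono) auto
    then show "min (f x) (of_nat m) * min (g y) (of_nat n) \<le> (h ((x + y) / 2))\<^sup>2"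
      using mid order_trans by blast
  qed (auto simp: min_le_iff_disj ennreal_of_nat_eq_real_of_nat[symmetric] simp del: of_nat_max intro!: disjI2 of_nat_mono)
  have F: "(\<integral>\<^sup>+x. f x \<partial>lborel) = (SUP n. \<integral>\<^sup>+x. min (f x) (of_nat n) \<partial>lborel)"
    by (rule nn_integral_eq_SUP_truncations) simp
  have G: "(\<integral>\<^sup>+x. g x \<partial>lborel) = (SUP n. \<integral>\<^sup>+x. min (g x) (of_nat n) \<partial>lborel)"
    by (rule nn_integral_eq_SUP_truncations) simp
  show ?thesis
    unfolding F G SUP_mult_right_ennreal SUP_mult_left_ennreal
    by (intro SUP_least *)
qed

text \<open>
The inequality tensorises: integrating out one coordinate with the one-dimensional case turns the
hypothesis for \<open>f\<close>, \<open>g\<close>, \<open>h\<close> into the same hypothesis for their marginals.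
\<close>

lemma prekopa_leindler_midpoint_PiM:
  fixes f g h :: "('i \<Rightarrow> real) \<Rightarrow> ennreal"
  assumes "finite I"
    and "f \<in> borel_measurable (PiM I (\<lambda>_. lborel))" "g \<in> borel_measurable (PiM I (\<lambda>_. lborel))"
      "h \<in> borel_measurable (PiM I (\<lambda>_. lborel))"
    and "\<And>x y. x \<in> extensional I \<Longrightarrow> y \<in> extensional I \<Longrightarrow>
      f x * g y \<le> (h (\<lambda>i\<in>I. (x i + y i) / 2))\<^sup>2"
  shows "(\<integral>\<^sup>+x. f x \<partial>PiM I (\<lambda>_. lborel)) * (\<integral>\<^sup>+x. g x \<partial>PiM I (\<lambda>_. lborel))
    \<le> (\<integral>\<^sup>+x. h x \<partial>PiM I (\<lambda>_. lborel))\<^sup>2"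
  using assms
proof (induction I arbitrary: f g h rule: finite_induct)
  case empty
  interpret product_sigma_finite "\<lambda>_::'i. lborel :: real measure" ..
  have "(\<lambda>i\<in>{}. ((\<lambda>_. undefined) i + (\<lambda>_. undefined) i) / 2 :: real) = (\<lambda>_::'i. undefined)" by auto
  then show ?case using empty(4)[of "\<lambda>_. undefined" "\<lambda>_. undefined"]
    by (simp add: nn_integral_empty)
next
  case (insert i I)
  interpret product_sigma_finite "\<lambda>_::'i. lborel :: real measure" ..
  note [measurable] = insert.prems(1-3)
  have upd: "(\<lambda>u. \<phi> (x(i := u))) \<in> borel_measurable borel"
    if "x \<in> extensional I" "\<phi> \<in> borel_measurable (PiM (insert i I) (\<lambda>_. lborel :: real measure))"
    for x and \<phi> :: "('i \<Rightarrow> real) \<Rightarrow> ennreal"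
  proof -
    have "x \<in> space (PiM I (\<lambda>_. lborel :: real measure))"
      using that by (simp add: space_PiM PiE_def)
    then have "(\<lambda>u. x(i := u)) \<in> lborel \<rightarrow>\<^sub>M PiM (insert i I) (\<lambda>_. lborel :: real measure)"
      using insert.hyps by (intro measurable_component_update) auto
    from measurable_compose[OF this that(2)] show ?thesis by simp
  qed
  have "(\<integral>\<^sup>+x. (\<integral>\<^sup>+u. f (x(i := u)) \<partial>lborel) \<partial>PiM I (\<lambda>_. lborel))
      * (\<integral>\<^sup>+x. (\<integral>\<^sup>+u. g (x(i := u)) \<partial>lborel) \<partial>PiM I (\<lambda>_. lborel))
    \<le> (\<integral>\<^sup>+x. (\<integral>\<^sup>+u. h (x(i := u)) \<partial>lborel) \<partial>PiM I (\<lambda>_. lborel))\<^sup>2"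
  proof (rule insert.IH)
    fix x y :: "'i \<Rightarrow> real" assume xy: "x \<in> extensional I" "y \<in> extensional I"
    let ?z = "\<lambda>i\<in>I. (x i + y i) / 2"
    show "(\<integral>\<^sup>+u. f (x(i := u)) \<partial>lborel) * (\<integral>\<^sup>+u. g (y(i := u)) \<partial>lborel) \<le> (\<integral>\<^sup>+u. h (?z(i := u)) \<partial>lborel)\<^sup>2"
    proof (rule prekopa_leindler_midpoint_real)
      fix u v :: real
      have *: "(\<lambda>j\<in>insert i I. ((x(i := u)) j + (y(i := v)) j) / 2) = ?z(i := (u + v) / 2)"
        using insert.hyps by (auto simp: fun_eq_iff)
      show "f (x(i := u)) * g (y(i := v)) \<le> (h (?z(i := (u + v) / 2)))\<^sup>2"
        unfolding *[symmetric] by (rule insert.prems(4)) (use xy in \<open>auto simp: extensional_def\<close>)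
    qed (use xy upd in auto)
  qed measurable
  then show ?case
    by (simp only: product_nn_integral_insert[OF insert.hyps insert.prems(1)]
        product_nn_integral_insert[OF insert.hyps insert.prems(2)]
        product_nn_integral_insert[OF insert.hyps insert.prems(3)])
qed

lemma prekopa_leindler_midpoint:
  fixes f g h :: "'a::euclidean_space \<Rightarrow> ennreal"
  assumes [measurable]: "f \<in> borel_measurable borel" "g \<in> borel_measurable borel"
      "h \<in> borel_measurable borel"
    and mid: "\<And>x y. f x * g y \<le> (h ((1/2) *\<^sub>R (x + y)))\<^sup>2"
  shows "(\<integral>\<^sup>+x. f x \<partial>lborel) * (\<integral>\<^sup>+x. g x \<partial>lborel) \<le> (\<integral>\<^sup>+x. h x \<partial>lborel)\<^sup>2"
proof -
  let ?L = "\<lambda>x. \<Sum>b\<in>Basis. x b *\<^sub>R b :: 'a"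
  have eq: "(\<integral>\<^sup>+x. \<phi> x \<partial>lborel) = (\<integral>\<^sup>+x. \<phi> (?L x) \<partial>PiM Basis (\<lambda>_. lborel))"
    if [measurable]: "\<phi> \<in> borel_measurable borel" for \<phi> :: "'a \<Rightarrow> ennreal"
    by (subst lborel_eq) (simp add: nn_integral_distr)
  have half: "?L (\<lambda>b\<in>Basis. (x b + y b) / 2) = (1/2) *\<^sub>R (?L x + ?L y)" for x y
    by (simp add: scaleR_sum_right sum.distrib[symmetric] scaleR_add_left[symmetric] add_divide_distrib)
  show ?thesis
    unfolding eq[OF assms(1)] eq[OF assms(2)] eq[OF assms(3)]
  proof (rule prekopa_leindler_midpoint_PiM)
    show "f (?L x) * g (?L y) \<le> (h (?L (\<lambda>b\<in>Basis. (x b + y b) / 2)))\<^sup>2" for x y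
      unfolding half by (rule mid)
  qed auto
qed

section \<open>The normal tail function\<close>

definition gauss_tail :: "real \<Rightarrow> real" where
  "gauss_tail m = (\<integral>u. indicator {m<..} u * exp (- u\<^sup>2 / 2) \<partial>lborel)"

text \<open>
The mean of \<open>\<bar>Z\<bar>\<close> for a standard normal \<open>Z\<close>, and also the density of \<open>\<bar>Z\<bar>\<close> at zero:
the value of both the mean and the boundary density of every coordinate when \<open>G\<close> is the
identity and the law is conditioned on the orthant.
\<close>

definition half_normal_mean :: real where
  "half_normal_mean = sqrt (2 / pi)"

lemma half_normal_mean_pos [simp]: "0 < half_normal_mean"
  by (simp add: half_normal_mean_def)

lemma half_normal_mean_sq: "half_normal_mean\<^sup>2 = 2 / pi"
  by (simp add: half_normal_mean_def)

lemma half_normal_mean_sq_bounds: "1 / 2 < half_normal_mean\<^sup>2" "half_normal_mean\<^sup>2 < 1"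
  using pi_less_4 pi_gt3 by (simp_all add: half_normal_mean_sq field_simps)

lemma sqrt_2_pi_times_half_normal_mean: "sqrt (2 * pi) * half_normal_mean = 2"
  by (simp add: half_normal_mean_def real_sqrt_mult[symmetric])

lemma has_bochner_integral_gauss:
  "has_bochner_integral lborel (\<lambda>u::real. exp (- u\<^sup>2 / 2)) (sqrt (2 * pi))"
proof -
  have "has_bochner_integral lborel (\<lambda>u. sqrt (2 * pi) * std_normal_density u) (sqrt (2 * pi) * 1)"
    by (intro has_bochner_integral_mult_right) (auto simp: has_bochner_integral_iff)
  then show ?thesis by (simp add: std_normal_density_def)
qed

lemmas integrable_gauss = has_bochner_integral_gauss[THEN integrable.intros]

lemma integrable_gauss_moment: "integrable lborel (\<lambda>u::real. u * exp (- u\<^sup>2 / 2))"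
proof -
  have "integrable lborel (\<lambda>u. sqrt (2 * pi) * (std_normal_density u * u ^ 1))"
    by (intro integrable_mult_right integrable_std_normal_moment)
  then show ?thesis by (simp add: std_normal_density_def mult.commute)
qed

lemma integrable_indicator_times:
  fixes f :: "'a::euclidean_space \<Rightarrow> real"
  assumes "integrable lborel f" and [measurable]: "A \<in> sets borel"
  shows "integrable lborel (\<lambda>u. indicator A u * f u)"
  using integrable_mult_indicator[of A lborel f] assms by simp

lemma gauss_tail_moment:
  fixes m :: real
  shows "(\<integral>u. indicator {m<..} u * (u * exp (- u\<^sup>2 / 2)) \<partial>lborel) = exp (- m\<^sup>2 / 2)"
proof -
  have set: "set_integrable lborel {m<..} (\<lambda>u. u * exp (- u\<^sup>2 / 2) :: real)"
    unfolding set_integrable_def real_scaleR_def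
    by (rule integrable_indicator_times[OF integrable_gauss_moment]) simp
  have "(LBINT u=ereal m..\<infinity>. u * exp (- u\<^sup>2 / 2)) = 0 - (- exp (- m\<^sup>2 / 2))"
  proof (rule interval_integral_FTC_integrable)
    show "((\<lambda>u. - exp (- u\<^sup>2 / 2)) has_vector_derivative u * exp (- u\<^sup>2 / 2)) (at u)" for u :: real
      unfolding has_real_derivative_iff_has_vector_derivative[symmetric]
      by (auto intro!: derivative_eq_intros)
    show "isCont (\<lambda>u::real. u * exp (- u\<^sup>2 / 2)) u" for u
      by (intro continuous_intros) auto
    show "set_integrable lborel (einterval (ereal m) \<infinity>) (\<lambda>u. u * exp (- u\<^sup>2 / 2))"
      using set by simp
    have "((\<lambda>u. - exp (- u\<^sup>2 / 2)) \<longlongrightarrow> - exp (- m\<^sup>2 / 2)) (at_right m)"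
      by (intro tendsto_intros) auto
    then show "(((\<lambda>u. - exp (- u\<^sup>2 / 2)) \<circ> real_of_ereal) \<longlongrightarrow> - exp (- m\<^sup>2 / 2)) (at_right (ereal m))"
      by (simp add: ereal_tendsto_simps1)
    have "((\<lambda>u::real. - exp (- u\<^sup>2 / 2)) \<longlongrightarrow> 0) at_top" by real_asymp
    then show "(((\<lambda>u. - exp (- u\<^sup>2 / 2)) \<circ> real_of_ereal) \<longlongrightarrow> 0) (at_left \<infinity>)"
      by (simp add: ereal_tendsto_simps1)
  qed simp
  then show ?thesis
    by (simp add: interval_lebesgue_integral_def set_lebesgue_integral_def)
qed

lemma gauss_tail_0: "gauss_tail 0 = 1 / half_normal_mean"
proof -
  have "sqrt (2 * pi) = (\<integral>u. exp (- u\<^sup>2 / 2) \<partial>lborel)"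
    using has_bochner_integral_gauss by (simp add: has_bochner_integral_iff)
  also have "\<dots> = (\<integral>u. indicator {0<..} u * exp (- u\<^sup>2 / 2) + indicator {..<0} u * exp (- u\<^sup>2 / 2) \<partial>lborel)"
    by (intro integral_cong_AE AE_I[where N = "{0}"]) (auto split: split_indicator)
  also have "\<dots> = gauss_tail 0 + (\<integral>u. indicator {..<0} u * exp (- u\<^sup>2 / 2) \<partial>lborel)"
    unfolding gauss_tail_def
    by (intro Bochner_Integration.integral_add integrable_indicator_times integrable_gauss) auto
  also have "(\<integral>u. indicator {..<0} u * exp (- u\<^sup>2 / 2) \<partial>lborel) = gauss_tail 0"
    unfolding gauss_tail_def
    by (subst lborel_integral_real_affine[where c = "-1" and t = 0])
       (auto intro!: Bochner_Integration.integral_cong split: split_indicator)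
  finally have "gauss_tail 0 = sqrt (2 * pi) / 2" by simp
  also have "\<dots> = 1 / half_normal_mean"
    by (simp add: half_normal_mean_def real_sqrt_divide real_sqrt_mult field_simps)
  finally show ?thesis .
qed

lemma gauss_tail_diff:
  assumes "a \<le> x"
  shows "gauss_tail x = gauss_tail a - integral {a..x} (\<lambda>u. exp (- u\<^sup>2 / 2))"
proof -
  have set: "set_integrable lborel {a..x} (\<lambda>u. exp (- u\<^sup>2 / 2))"
    unfolding set_integrable_def real_scaleR_def
    by (rule integrable_indicator_times[OF integrable_gauss]) simp
  have "gauss_tail a = (\<integral>u. indicator {x<..} u * exp (- u\<^sup>2 / 2) + indicator {a..x} u * exp (- u\<^sup>2 / 2) \<partial>lborel)"
    unfolding gauss_tail_def using assms
    by (intro integral_cong_AE AE_I[where N = "{a}"]) (auto split: split_indicator)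
  also have "\<dots> = gauss_tail x + (\<integral>u. indicator {a..x} u * exp (- u\<^sup>2 / 2) \<partial>lborel)"
    unfolding gauss_tail_def
    by (intro Bochner_Integration.integral_add integrable_indicator_times integrable_gauss) auto
  also have "(\<integral>u. indicator {a..x} u * exp (- u\<^sup>2 / 2) \<partial>lborel) = integral {a..x} (\<lambda>u. exp (- u\<^sup>2 / 2))"
    using set_borel_integral_eq_integral(2)[OF set] by (simp add: set_lebesgue_integral_def)
  finally show ?thesis by simp
qed

lemma gauss_tail_has_derivative:
  "(gauss_tail has_real_derivative - exp (- m\<^sup>2 / 2)) (at m)"
proof -
  let ?a = "m - 1"
  have "((\<lambda>x. integral {?a..x} (\<lambda>u. exp (- u\<^sup>2 / 2))) has_real_derivative exp (- m\<^sup>2 / 2)) (at m within {?a..m + 1})"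
    by (intro integral_has_real_derivative continuous_intros) auto
  then have "((\<lambda>x. integral {?a..x} (\<lambda>u. exp (- u\<^sup>2 / 2))) has_real_derivative exp (- m\<^sup>2 / 2)) (at m)"
    by (simp add: at_within_Icc_at)
  then have "((\<lambda>x. gauss_tail ?a - integral {?a..x} (\<lambda>u. exp (- u\<^sup>2 / 2))) has_real_derivative - exp (- m\<^sup>2 / 2)) (at m)"
    by (auto intro!: derivative_eq_intros)
  then show ?thesis
  proof (rule has_field_derivative_transform_within_open)
    show "open {?a<..}" by simp
    show "gauss_tail ?a - integral {?a..x} (\<lambda>u. exp (- u\<^sup>2 / 2)) = gauss_tail x" if "x \<in> {?a<..}" for x
      using gauss_tail_diff[of ?a x] that by simp
  qed auto
qed

text \<open>
Compare with \<open>u exp (- u\<^sup>2 / 2)\<close>, which has an elementary integral and dominates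
\<open>m exp (- u\<^sup>2 / 2)\<close> for \<open>u > m\<close>.
\<close>

lemma mult_gauss_tail_le:
  assumes "0 < m"
  shows "m * gauss_tail m \<le> exp (- m\<^sup>2 / 2)"
proof -
  have "m * gauss_tail m = (\<integral>u. indicator {m<..} u * (m * exp (- u\<^sup>2 / 2)) \<partial>lborel)"
    unfolding gauss_tail_def by (simp flip: integral_mult_right_zero add: ac_simps)
  also have "\<dots> \<le> (\<integral>u. indicator {m<..} u * (u * exp (- u\<^sup>2 / 2)) \<partial>lborel)"
    by (intro integral_mono integrable_indicator_times integrable_gauss integrable_mult_right integrable_gauss_moment)
       (auto split: split_indicator)
  finally show ?thesis unfolding gauss_tail_moment .
qed

lemma gauss_tail_nonneg: "0 \<le> gauss_tail m"
  unfolding gauss_tail_def by (intro Bochner_Integration.integral_nonneg) auto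

text \<open>
The inverse Mills ratio \<open>exp (- m\<^sup>2 / 2) / gauss_tail m\<close> is convex, and the linear function on
the left is its tangent at zero.  The bound can be verified directly:
where the linear function is positive, let \<open>D\<close> be the difference of the two sides divided by it.  Then
\<open>D\<close> vanishes at zero and its derivative has the sign of \<open>x (c - x)\<close> for a constant \<open>c > 0\<close>.  So \<open>D\<close>
decreases up to zero, increases up to \<open>c\<close>, and decreases afterwards; on the last piece it is
nonnegative because it is so far out.
\<close>

lemma inverse_mills_ratio_tangent:
  "(half_normal_mean + half_normal_mean\<^sup>2 * m) * gauss_tail m \<le> exp (- m\<^sup>2 / 2)"
proof -
  define k where "k = half_normal_mean"
  define q where "q x = k + k\<^sup>2 * x" for x
  define D where "D x = exp (- x\<^sup>2 / 2) / q x - gauss_tail x" for x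
  define c where "c = (2 * k\<^sup>2 - 1) / (k * (1 - k\<^sup>2))"
  have k: "0 < k" "1 / 2 < k\<^sup>2" "k\<^sup>2 < 1"
    using half_normal_mean_sq_bounds by (simp_all add: k_def)
  have c: "0 < c" using k by (simp add: c_def)
  have deriv: "(D has_real_derivative exp (- x\<^sup>2 / 2) / (q x)\<^sup>2 * (x * (k\<^sup>2 * (1 - k\<^sup>2) * (c - x)))) (at x)"
    if "0 < q x" for x
  proof -
    have "(D has_real_derivative
        (- x * exp (- x\<^sup>2 / 2) * q x - exp (- x\<^sup>2 / 2) * k\<^sup>2) / (q x)\<^sup>2 + exp (- x\<^sup>2 / 2)) (at x)"
      unfolding D_def[abs_def] q_def[abs_def] using that
      by (auto intro!: derivative_eq_intros gauss_tail_has_derivative simp: q_def power2_eq_square)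
    moreover have "(- x * exp (- x\<^sup>2 / 2) * q x - exp (- x\<^sup>2 / 2) * k\<^sup>2) / (q x)\<^sup>2 + exp (- x\<^sup>2 / 2)
        = exp (- x\<^sup>2 / 2) / (q x)\<^sup>2 * ((q x)\<^sup>2 - x * q x - k\<^sup>2)"
      using that by (simp add: field_simps)
    moreover have "k\<^sup>2 * (1 - k\<^sup>2) * c = k * (2 * k\<^sup>2 - 1)"
      using k by (simp add: c_def power2_eq_square)
    then have "k\<^sup>2 * (1 - k\<^sup>2) * (c - x) = k * (2 * k\<^sup>2 - 1) - k\<^sup>2 * (1 - k\<^sup>2) * x"
      by (simp only: right_diff_distrib[of _ c])
    then have "(q x)\<^sup>2 - x * q x - k\<^sup>2 = x * (k\<^sup>2 * (1 - k\<^sup>2) * (c - x))"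
      by (simp only:) (simp add: q_def power2_eq_square algebra_simps)
    ultimately show ?thesis by simp
  qed
  have D0: "D 0 = 0" by (simp add: D_def q_def gauss_tail_0 k_def)
  have D_nonneg: "0 \<le> D m" if "0 < q m"
  proof -
    have qpos: "0 < q x" if "m \<le> x" for x
      using \<open>0 < q m\<close> mult_left_mono[OF that zero_le_power2[of k]] unfolding q_def by linarith
    consider "m \<le> 0" | "0 \<le> m" "m \<le> c" | "c \<le> m" by linarith
    then show ?thesis
    proof cases
      case 1
      have "D 0 \<le> D m"
      proof (rule DERIV_nonpos_imp_nonincreasing[OF 1])
        fix x assume x: "m \<le> x" "x \<le> 0"
        have "exp (- x\<^sup>2 / 2) / (q x)\<^sup>2 * (x * (k\<^sup>2 * (1 - k\<^sup>2) * (c - x))) \<le> 0"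
          using x k c by (intro mult_nonneg_nonpos mult_nonpos_nonneg mult_nonneg_nonneg) auto
        then show "\<exists>y. (D has_real_derivative y) (at x) \<and> y \<le> 0" using deriv[OF qpos[OF x(1)]] by blast
      qed
      then show ?thesis using D0 by simp
    next
      case 2
      have "D 0 \<le> D m"
      proof (rule DERIV_nonneg_imp_nondecreasing[OF 2(1)])
        fix x assume x: "0 \<le> x" "x \<le> m"
        have "0 \<le> exp (- x\<^sup>2 / 2) / (q x)\<^sup>2 * (x * (k\<^sup>2 * (1 - k\<^sup>2) * (c - x)))"
          using x k 2 by (intro mult_nonneg_nonneg) auto
        moreover have "0 < q x" using x k by (auto simp: q_def intro: add_pos_nonneg)
        ultimately show "\<exists>y. (D has_real_derivative y) (at x) \<and> 0 \<le> y" using deriv by blast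
      qed
      then show ?thesis using D0 by simp
    next
      case 3
      \<comment> \<open>Beyond \<open>k / (1 - k\<^sup>2)\<close> the tangent lies below the diagonal, so the elementary
        tail bound applies.\<close>
      define M where "M = max m (k / (1 - k\<^sup>2))"
      have M: "m \<le> M" "0 < M" using 3 c by (auto simp: M_def)
      have "k / (1 - k\<^sup>2) \<le> M" by (simp add: M_def)
      then have "q M \<le> M" using k by (simp add: q_def field_simps)
      then have "q M * gauss_tail M \<le> exp (- M\<^sup>2 / 2)"
        using mult_gauss_tail_le[OF M(2)] mult_right_mono[OF _ gauss_tail_nonneg] order_trans by blast
      then have "0 \<le> D M" using qpos[OF M(1)] by (simp add: D_def field_simps)
      moreover have "D M \<le> D m"
      proof (rule DERIV_nonpos_imp_nonincreasing[OF M(1)])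
        fix x assume x: "m \<le> x" "x \<le> M"
        have "exp (- x\<^sup>2 / 2) / (q x)\<^sup>2 * (x * (k\<^sup>2 * (1 - k\<^sup>2) * (c - x))) \<le> 0"
          using x k c 3 by (intro mult_nonneg_nonpos) auto
        then show "\<exists>y. (D has_real_derivative y) (at x) \<and> y \<le> 0" using deriv[OF qpos[OF x(1)]] by blast
      qed
      ultimately show ?thesis by simp
    qed
  qed
  show ?thesis
  proof (cases "0 < q m")
    case True
    then show ?thesis using D_nonneg by (simp add: D_def q_def k_def field_simps)
  next
    case False
    then have "q m * gauss_tail m \<le> 0" using gauss_tail_nonneg by (simp add: mult_nonpos_nonneg)
    then show ?thesis unfolding q_def k_def using exp_ge_zero order_trans by blast
  qed
qed

section \<open>Gaussian weights\<close>

lemma integrable_exp_neg_norm_sq: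
  assumes "0 < c"
  shows "integrable lborel (\<lambda>x::'a::euclidean_space. exp (- c * (x \<bullet> x)))"
proof (rule integrableI_nonneg)
  let ?g = "\<lambda>u::real. exp (- c * u\<^sup>2)"
  have "integrable lborel (\<lambda>u. exp (- (0 + sqrt (2 * c) * u)\<^sup>2 / 2))"
    using assms by (intro lborel_integrable_real_affine[OF integrable_gauss]) auto
  also have "(\<lambda>u. exp (- (0 + sqrt (2 * c) * u)\<^sup>2 / 2)) = ?g"
    using assms by (simp add: power_mult_distrib)
  finally have g: "(\<integral>\<^sup>+u. ennreal (?g u) \<partial>lborel) < \<infinity>"
    by (simp add: integrable_iff_bounded)
  have "(\<integral>\<^sup>+x. ennreal (exp (- c * (x \<bullet> x))) \<partial>(lborel :: 'a measure))
      = (\<integral>\<^sup>+x. (\<Prod>b\<in>Basis. ennreal (?g (x \<bullet> b))) \<partial>(lborel :: 'a measure))"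
    by (intro nn_integral_cong)
       (simp add: euclidean_inner[of x x for x :: 'a] prod_ennreal exp_sum[symmetric] sum_distrib_left
         power2_eq_square sum_negf)
  also have "\<dots> = (\<Prod>b\<in>(Basis :: 'a set). (\<integral>\<^sup>+u. ennreal (?g u) \<partial>lborel))"
    by (rule nn_integral_lborel_prod) auto
  also have "\<dots> < \<infinity>" using g by (simp add: power_less_top_ennreal)
  finally show "(\<integral>\<^sup>+x. ennreal (exp (- c * (x \<bullet> x))) \<partial>(lborel :: 'a measure)) < \<infinity>" .
qed auto

lemma integrable_lborel_translate:
  fixes f :: "'a::euclidean_space \<Rightarrow> real"
  assumes "integrable lborel f"
  shows "integrable lborel (\<lambda>x. f (a + x))"
proof -
  have "integrable (distr lborel borel ((+) a)) f"
    using assms by (simp add: lborel_distr_plus)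
  then show ?thesis by (subst (asm) integrable_distr_eq) (use assms in auto)
qed

lemma integral_lborel_translate:
  fixes f :: "'a::euclidean_space \<Rightarrow> real"
  assumes "f \<in> borel_measurable borel"
  shows "(\<integral>x. f (a + x) \<partial>lborel) = (\<integral>x. f x \<partial>lborel)"
proof -
  have "(\<integral>x. f x \<partial>lborel) = (\<integral>x. f x \<partial>distr lborel borel ((+) a))"
    by (simp add: lborel_distr_plus)
  also have "\<dots> = (\<integral>x. f (a + x) \<partial>lborel)"
    by (rule integral_distr) (use assms in auto)
  finally show ?thesis by simp
qed

text \<open>
This is how every inequality in one coordinate is lifted to the whole space: by Fubini, the sign
of an integral can be checked on the lines parallel to one axis, each represented by the point
where it meets the coordinate hyperplane.
\<close>

lemma integral_nonneg_if_line_integrals_nonneg: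
  fixes f :: "'a::euclidean_space \<Rightarrow> real"
  assumes f: "integrable lborel f" and b: "b \<in> Basis"
    and nonneg: "\<And>x. x \<bullet> b = 0 \<Longrightarrow> 0 \<le> (\<integral>s. f (x + s *\<^sub>R b) \<partial>lborel)"
  shows "0 \<le> (\<integral>x. f x \<partial>lborel)"
proof -
  interpret product_sigma_finite "\<lambda>_::'a. lborel :: real measure" ..
  let ?B = "Basis - {b}"
  let ?L = "\<lambda>x. \<Sum>c\<in>Basis. x c *\<^sub>R c :: 'a"
  have B: "Basis = insert b ?B" using b by auto
  have [measurable]: "f \<in> borel_measurable borel" using f by simp
  have int: "integrable (PiM (insert b ?B) (\<lambda>_. lborel)) (\<lambda>x. f (?L x))"
    using f unfolding B[symmetric] by (subst (asm) lborel_eq) (simp add: integrable_distr_eq)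
  have "(\<integral>x. f x \<partial>lborel) = (\<integral>x. f (?L x) \<partial>PiM (insert b ?B) (\<lambda>_. lborel))"
    unfolding B[symmetric] by (subst lborel_eq) (simp add: integral_distr)
  also have "\<dots> = (\<integral>x. (\<integral>s. f (?L (x(b := s))) \<partial>lborel) \<partial>PiM ?B (\<lambda>_. lborel))"
    by (rule product_integral_insert[OF _ _ int]) auto
  also have "\<dots> = (\<integral>x. (\<integral>s. f ((\<Sum>c\<in>?B. x c *\<^sub>R c) + s *\<^sub>R b) \<partial>lborel) \<partial>PiM ?B (\<lambda>_. lborel))"
    using b by (simp add: sum.remove[of Basis b] add.commute)
  also have "0 \<le> \<dots>"
    using b by (intro Bochner_Integration.integral_nonneg nonneg) (auto simp: inner_sum_left inner_Basis intro!: sum.neutral)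
  finally show ?thesis .
qed

lemma integral_zero_if_line_integrals_zero:
  fixes f :: "'a::euclidean_space \<Rightarrow> real"
  assumes f: "integrable lborel f" and b: "b \<in> Basis"
    and zero: "\<And>x. x \<bullet> b = 0 \<Longrightarrow> (\<integral>s. f (x + s *\<^sub>R b) \<partial>lborel) = 0"
  shows "(\<integral>x. f x \<partial>lborel) = 0"
proof (rule antisym)
  show "0 \<le> (\<integral>x. f x \<partial>lborel)"
    by (rule integral_nonneg_if_line_integrals_nonneg[OF f b]) (simp add: zero)
  have "0 \<le> (\<integral>x. - f x \<partial>lborel)"
    by (rule integral_nonneg_if_line_integrals_nonneg[OF _ b]) (use f in \<open>auto simp: zero\<close>)
  then show "(\<integral>x. f x \<partial>lborel) \<le> 0" by simp
qed

lemma sym_pos_def_inner_commute: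
  assumes "sym_pos_def G"
  shows "(G *v x) \<bullet> y = (G *v y) \<bullet> x"
  using assms dot_lmul_matrix[of y G x] unfolding sym_pos_def_def
  by (metis inner_commute transpose_matrix_vector)

lemma sym_pos_def_nonneg:
  assumes "sym_pos_def G"
  shows "0 \<le> (G *v x) \<bullet> x"
  using assms unfolding sym_pos_def_def by (cases "x = 0") (auto intro: less_imp_le)

text \<open>
A continuous function attains its minimum on the unit sphere.
\<close>

lemma sym_pos_def_coercive:
  fixes G :: "real ^ 'n ^ 'n"
  assumes "sym_pos_def G"
  obtains c where "0 < c" "\<And>x. c * (x \<bullet> x) \<le> (G *v x) \<bullet> x"
proof -
  have "\<exists>z\<in>sphere 0 1. \<forall>x\<in>sphere 0 1. (G *v z) \<bullet> z \<le> (G *v x) \<bullet> x"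
  proof (rule continuous_attains_inf)
    show "sphere (0 :: real ^ 'n) 1 \<noteq> {}" by (simp add: sphere_eq_empty)
    show "continuous_on (sphere 0 1) (\<lambda>x. (G *v x) \<bullet> x)"
      by (intro continuous_intros matrix_vector_mult_linear_continuous_on)
  qed simp
  then obtain z where z: "norm z = 1" "\<And>x. norm x = 1 \<Longrightarrow> (G *v z) \<bullet> z \<le> (G *v x) \<bullet> x"
    by auto
  show ?thesis
  proof (rule that)
    have "z \<noteq> 0" using z(1) by auto
    then show "0 < (G *v z) \<bullet> z" using assms unfolding sym_pos_def_def by blast
    show "(G *v z) \<bullet> z * (x \<bullet> x) \<le> (G *v x) \<bullet> x" for x
    proof (cases "x = 0")
      case False
      have "(G *v z) \<bullet> z \<le> (G *v (inverse (norm x) *\<^sub>R x)) \<bullet> (inverse (norm x) *\<^sub>R x)"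
        using False by (intro z(2)) simp
      also have "\<dots> = ((G *v x) \<bullet> x) / (norm x)\<^sup>2"
        by (simp add: matrix_vector_mult_scaleR power2_eq_square field_simps)
      finally show ?thesis using False by (simp add: power2_norm_eq_inner field_simps)
    qed simp
  qed
qed

definition gauss_weight :: "real ^ 'n ^ 'n \<Rightarrow> real ^ 'n \<Rightarrow> real" where
  "gauss_weight G x = exp (- ((G *v x) \<bullet> x) / 2)"

lemma borel_measurable_matrix_vector_mult [measurable]:
  "(*v) (G :: real ^ 'n ^ 'm) \<in> borel_measurable borel"
  by (intro borel_measurable_continuous_onI matrix_vector_mult_linear_continuous_on)

lemma borel_measurable_gauss_weight [measurable]: "gauss_weight G \<in> borel_measurable borel"
  unfolding gauss_weight_def[abs_def] by measurable

lemma gauss_weight_pos [simp]: "0 < gauss_weight G x"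
  by (simp add: gauss_weight_def)

lemma open_pos_orthant: "open (pos_orthant :: (real ^ 'n) set)"
proof -
  have "pos_orthant = (\<Inter>j. {x :: real ^ 'n. 0 < x $ j})" by (auto simp: pos_orthant_def)
  also have "open \<dots>" by (intro open_INT ballI open_Collect_less continuous_intros) simp
  finally show ?thesis .
qed

lemma open_pos_except: "open (pos_except i :: (real ^ 'n) set)"
proof -
  have "pos_except i = (\<Inter>j\<in>UNIV - {i}. {x :: real ^ 'n. 0 < x $ j})" by (auto simp: pos_except_def)
  also have "open \<dots>" by (intro open_INT ballI open_Collect_less continuous_intros) simp
  finally show ?thesis .
qed

lemma pos_orthant_borel [measurable]: "(pos_orthant :: (real ^ 'n) set) \<in> sets borel"
  and pos_except_borel [measurable]: "(pos_except i :: (real ^ 'n) set) \<in> sets borel"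
  by (simp_all add: open_pos_orthant open_pos_except)

lemma integrable_gauss_weight:
  assumes "sym_pos_def G"
  shows "integrable lborel (gauss_weight G)"
proof -
  obtain c where c: "0 < c" "\<And>x. c * (x \<bullet> x) \<le> (G *v x) \<bullet> x"
    using sym_pos_def_coercive[OF assms] by blast
  show ?thesis
  proof (rule Bochner_Integration.integrable_bound)
    show "integrable lborel (\<lambda>x::real ^ 'a. exp (- (c / 2) * (x \<bullet> x)))"
      by (rule integrable_exp_neg_norm_sq) (use c in simp)
  qed (use c in \<open>auto simp: gauss_weight_def\<close>)
qed

lemma integrable_component_gauss_weight:
  assumes "sym_pos_def G"
  shows "integrable lborel (\<lambda>x. x $ j * gauss_weight G x)"
proof -
  obtain c where c: "0 < c" "\<And>x. c * (x \<bullet> x) \<le> (G *v x) \<bullet> x"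
    using sym_pos_def_coercive[OF assms] by blast
  show ?thesis
  proof (rule Bochner_Integration.integrable_bound)
    show "integrable lborel (\<lambda>x::real ^ 'a. (1 + 4 / c) * exp (- (c / 4) * (x \<bullet> x)))"
      by (intro integrable_mult_right integrable_exp_neg_norm_sq) (use c in simp)
    have "norm (x $ j * gauss_weight G x) \<le> norm ((1 + 4 / c) * exp (- (c / 4) * (x \<bullet> x)))" for x :: "real ^ 'a"
    proof -
      \<comment> \<open>Half of the Gaussian decay absorbs the linear factor.\<close>
      have "\<bar>x $ j\<bar> \<le> 1 + (x $ j)\<^sup>2"
        using zero_le_power2[of "\<bar>x $ j\<bar> - 1"] by (simp add: power2_diff)
      also have "(x $ j)\<^sup>2 \<le> x \<bullet> x"
        unfolding power2_norm_eq_inner[symmetric] using component_le_norm_cart[of x j]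
        by (metis abs_le_square_iff abs_norm_cancel)
      also have "1 + x \<bullet> x \<le> (1 + 4 / c) * (1 + (c / 4) * (x \<bullet> x))"
        using c(1) by (simp add: field_simps)
      also have "\<dots> \<le> (1 + 4 / c) * exp ((c / 4) * (x \<bullet> x))"
        using c(1) by (intro mult_left_mono exp_ge_add_one_self) auto
      finally have 1: "\<bar>x $ j\<bar> \<le> (1 + 4 / c) * exp ((c / 4) * (x \<bullet> x))" by simp
      have 2: "gauss_weight G x \<le> exp (- (c / 2) * (x \<bullet> x))"
        using c(2)[of x] by (simp add: gauss_weight_def)
      have "\<bar>x $ j\<bar> * gauss_weight G x
          \<le> ((1 + 4 / c) * exp ((c / 4) * (x \<bullet> x))) * exp (- (c / 2) * (x \<bullet> x))"
        using c(1) by (intro mult_mono 1 2) (auto simp: less_imp_le)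
      also have "\<dots> = (1 + 4 / c) * exp (- (c / 4) * (x \<bullet> x))"
        by (simp add: exp_add[symmetric] field_simps)
      finally show ?thesis using c(1) by (simp add: abs_mult abs_of_pos)
    qed
    then show "AE x in lborel. norm (x $ j * gauss_weight G x) \<le> norm ((1 + 4 / c) * exp (- (c / 4) * (x \<bullet> x)))"
      by simp
  qed auto
qed

lemma matrix_vector_mult_component_expand:
  "(G *v x) $ i = (\<Sum>j\<in>UNIV. G $ i $ j * x $ j)"
  by (simp add: matrix_vector_mult_def)

lemma integrable_gradient_gauss_weight:
  assumes "sym_pos_def G"
  shows "integrable lborel (\<lambda>x. (G *v x) $ i * gauss_weight G x)"
  unfolding matrix_vector_mult_component_expand sum_distrib_right mult.assoc
  by (intro Bochner_Integration.integrable_sum integrable_mult_right integrable_component_gauss_weight assms)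

lemma quadratic_form_line:
  fixes G :: "real ^ 'n ^ 'n"
  assumes G: "sym_pos_def G" and diag: "G $ i $ i = 1"
  shows "(G *v (x + s *\<^sub>R axis i 1)) $ i = (G *v x) $ i + s"
    and "(G *v (x + s *\<^sub>R axis i 1)) \<bullet> (x + s *\<^sub>R axis i 1)
      = (G *v x) \<bullet> x + 2 * s * (G *v x) $ i + s\<^sup>2"
proof -
  have col: "(G *v axis i 1) $ i = 1"
    using diag by (simp add: matrix_vector_mul_component cart_eq_inner_axis[symmetric] inner_axis)
  show "(G *v (x + s *\<^sub>R axis i 1)) $ i = (G *v x) $ i + s"
    by (simp add: matrix_vector_right_distrib matrix_vector_mult_scaleR col)
  have "(G *v axis i 1) \<bullet> x = (G *v x) $ i"
    unfolding sym_pos_def_inner_commute[OF G, of "axis i 1" x] by (simp add: inner_axis)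
  then show "(G *v (x + s *\<^sub>R axis i 1)) \<bullet> (x + s *\<^sub>R axis i 1)
      = (G *v x) \<bullet> x + 2 * s * (G *v x) $ i + s\<^sup>2"
    by (simp add: matrix_vector_right_distrib matrix_vector_mult_scaleR inner_add_left inner_add_right
        inner_axis col power2_eq_square algebra_simps)
qed

text \<open>
Because the diagonal entry is one, the Gaussian weight restricted to a line in direction \<open>i\<close> is a
multiple of the standard normal weight, shifted by the value of \<open>(G x)\<^sub>i\<close> at the base
point.
\<close>

lemma gauss_weight_line:
  fixes G :: "real ^ 'n ^ 'n"
  assumes "sym_pos_def G" and "G $ i $ i = 1"
  shows "gauss_weight G (x + s *\<^sub>R axis i 1)
    = exp (((G *v x) $ i)\<^sup>2 / 2) * gauss_weight G x * exp (- ((G *v x) $ i + s)\<^sup>2 / 2)"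
  unfolding gauss_weight_def quadratic_form_line(2)[OF assms] exp_add[symmetric]
  by (rule arg_cong[of _ _ exp]) (simp add: power2_eq_square field_simps)

lemma pos_orthant_line:
  assumes "x $ i = 0"
  shows "x + s *\<^sub>R axis i 1 \<in> pos_orthant \<longleftrightarrow> x \<in> pos_except i \<and> 0 < s"
proof -
  have "(x + s *\<^sub>R axis i 1) $ j = (if j = i then s else x $ j)" for j
    using assms by (simp add: axis_def)
  then show ?thesis unfolding pos_orthant_def pos_except_def by (simp del: vector_add_component) metis
qed

lemma pos_except_line:
  "x + s *\<^sub>R axis i 1 \<in> pos_except i \<longleftrightarrow> x \<in> pos_except i"
proof -
  have "(x + s *\<^sub>R axis i 1) $ j = (if j = i then x $ i + s else x $ j)" for j
    by (simp add: axis_def)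
  then show ?thesis unfolding pos_except_def by (simp del: vector_add_component)
qed

lemma integral_gauss_shift:
  fixes m :: real
  shows "(\<integral>s. exp (- (m + s)\<^sup>2 / 2) \<partial>lborel) = sqrt (2 * pi)"
proof -
  have "sqrt (2 * pi) = (\<integral>u. exp (- (u::real)\<^sup>2 / 2) \<partial>lborel)"
    using has_bochner_integral_gauss by (rule has_bochner_integral_integral_eq[symmetric])
  also have "\<dots> = \<bar>1\<bar> *\<^sub>R (\<integral>s. exp (- (m + 1 * s)\<^sup>2 / 2) \<partial>lborel)"
    by (rule lborel_integral_real_affine) simp
  finally show ?thesis by simp
qed

lemma integral_gauss_half_line:
  fixes m :: real
  shows "(\<integral>s. indicator {0<..} s * exp (- (m + s)\<^sup>2 / 2) \<partial>lborel) = gauss_tail m"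
proof -
  have "gauss_tail m = \<bar>1\<bar> *\<^sub>R (\<integral>s. indicator {m<..} (m + 1 * s) * exp (- (m + 1 * s)\<^sup>2 / 2) \<partial>lborel)"
    unfolding gauss_tail_def by (rule lborel_integral_real_affine) simp
  then show ?thesis by (simp add: indicator_def)
qed

lemma integral_gauss_moment_half_line:
  fixes m :: real
  shows "(\<integral>s. indicator {0<..} s * ((m + s) * exp (- (m + s)\<^sup>2 / 2)) \<partial>lborel) = exp (- m\<^sup>2 / 2)"
proof -
  have "exp (- m\<^sup>2 / 2) = \<bar>1\<bar> *\<^sub>R (\<integral>s. indicator {m<..} (m + 1 * s) *
      ((m + 1 * s) * exp (- (m + 1 * s)\<^sup>2 / 2)) \<partial>lborel)"
    by (subst gauss_tail_moment[of m, symmetric], rule lborel_integral_real_affine) simp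
  then show ?thesis by (simp add: indicator_def)
qed

lemma integrable_gauss_half_line:
  fixes m :: real
  shows "integrable lborel (\<lambda>s. indicator {0<..} s * exp (- (m + s)\<^sup>2 / 2))"
  using lborel_integrable_real_affine[OF integrable_gauss, of 1 m]
  by (intro integrable_indicator_times) auto

lemma integrable_gauss_moment_half_line:
  fixes m :: real
  shows "integrable lborel (\<lambda>s. indicator {0<..} s * ((m + s) * exp (- (m + s)\<^sup>2 / 2)))"
  using lborel_integrable_real_affine[OF integrable_gauss_moment, of 1 m]
  by (intro integrable_indicator_times) auto

section \<open>Integrals over the orthant\<close>

lemma integral_pos_if_pos_on_open:
  fixes f :: "'a::euclidean_space \<Rightarrow> real"
  assumes f: "integrable lborel f" "\<And>x. 0 \<le> f x" and U: "open U" "U \<noteq> {}" "\<And>x. x \<in> U \<Longrightarrow> 0 < f x"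
  shows "0 < (\<integral>x. f x \<partial>lborel)"
proof (rule ccontr)
  assume "\<not> 0 < (\<integral>x. f x \<partial>lborel)"
  moreover have "0 \<le> (\<integral>x. f x \<partial>lborel)" using f by (intro Bochner_Integration.integral_nonneg) auto
  ultimately have "(\<integral>x. f x \<partial>lborel) = 0" by simp
  then have "AE x in lborel. f x = 0"
    using integral_nonneg_eq_0_iff_AE[OF f(1)] f(2) by simp
  then have "AE x in lborel. x \<notin> U" by eventually_elim (use U(3) in force)
  then have "U \<in> null_sets lborel"
    using U(1) by (subst AE_iff_null_sets) auto
  then have "U \<in> null_sets lebesgue" by (rule null_sets_completionI)
  then show False using open_not_negligible[OF U(1,2)] by (simp add: negligible_iff_null_sets)
qed

definition orthant_integral :: "real ^ 'n ^ 'n \<Rightarrow> (real ^ 'n \<Rightarrow> real) \<Rightarrow> real" where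
  "orthant_integral G f = (\<integral>x. indicator pos_orthant x * (f x * gauss_weight G x) \<partial>lborel)"

lemma orthant_integral_one_pos:
  fixes G :: "real ^ 'n ^ 'n"
  assumes "sym_pos_def G"
  shows "0 < orthant_integral G (\<lambda>_. 1)"
  unfolding orthant_integral_def
proof (rule integral_pos_if_pos_on_open[OF _ _ open_pos_orthant])
  show "integrable lborel (\<lambda>x. indicator pos_orthant x * (1 * gauss_weight G x))"
    using integrable_gauss_weight[OF assms] by (intro integrable_indicator_times) auto
  have "(1 :: real ^ 'n) \<in> pos_orthant" by (simp add: pos_orthant_def)
  then show "pos_orthant \<noteq> ({} :: (real ^ 'n) set)" by blast
qed (auto simp: less_imp_le split: split_indicator)

lemma orthant_integral_component_nonneg: "0 \<le> orthant_integral G (\<lambda>x. x $ i)"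
  unfolding orthant_integral_def
  by (intro Bochner_Integration.integral_nonneg) (auto simp: pos_orthant_def less_imp_le split: split_indicator)

text \<open>
With \<open>b\<^sub>i\<close> and \<open>\<mu>\<^sub>i\<close> the means of \<open>(G x)\<^sub>i\<close> and \<open>x\<^sub>i\<close> under the
Gaussian conditioned on the orthant, this is \<open>b = G \<mu>\<close> before normalisation.
\<close>

lemma orthant_integral_gradient:
  assumes "sym_pos_def G"
  shows "orthant_integral G (\<lambda>x. (G *v x) $ i) = (G *v (\<chi> j. orthant_integral G (\<lambda>x. x $ j))) $ i"
proof -
  have "orthant_integral G (\<lambda>x. (G *v x) $ i)
      = (\<integral>x. (\<Sum>j\<in>UNIV. G $ i $ j * (indicator pos_orthant x * (x $ j * gauss_weight G x))) \<partial>lborel)"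
    unfolding orthant_integral_def matrix_vector_mult_component_expand sum_distrib_right sum_distrib_left
    by (simp add: ac_simps)
  also have "\<dots> = (\<Sum>j\<in>UNIV. G $ i $ j * orthant_integral G (\<lambda>x. x $ j))"
    unfolding orthant_integral_def
    by (subst Bochner_Integration.integral_sum)
       (auto intro!: integrable_mult_right integrable_indicator_times
          integrable_component_gauss_weight assms)
  finally show ?thesis by (simp add: matrix_vector_mult_component_expand)
qed

text \<open>
As the diagonal of \<open>G\<close> is one, this is the sum of \<open>G $ i $ j * x $ j\<close> over \<open>j \<noteq> i\<close>: the
negative of the mean of coordinate \<open>i\<close> given the other coordinates, before conditioning on the
orthant.
\<close>

definition cross_term :: "real ^ 'n ^ 'n \<Rightarrow> 'n \<Rightarrow> real ^ 'n \<Rightarrow> real" where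
  "cross_term G i x = (G *v x) $ i - x $ i"

lemma borel_measurable_cross_term [measurable]: "cross_term G i \<in> borel_measurable borel"
proof -
  have "(\<lambda>x. cross_term G i x) = (\<lambda>x. ((*v) G x - x) $ i)" by (simp add: cross_term_def)
  also have "\<dots> \<in> borel_measurable borel"
    by (intro borel_measurable_continuous_onI continuous_intros matrix_vector_mult_linear_continuous_on)
  finally show ?thesis .
qed

lemma cross_term_line:
  fixes G :: "real ^ 'n ^ 'n"
  assumes "sym_pos_def G" "G $ i $ i = 1"
  shows "cross_term G i (x + s *\<^sub>R axis i 1) = cross_term G i x"
  using quadratic_form_line(1)[OF assms] by (simp add: cross_term_def)

text \<open>
Along a line in direction \<open>i\<close> whose other coordinates are positive, with \<open>m\<close> the cross term,
\<open>(G x)\<^sub>i\<close> times the weight integrates over the positive half to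
\<open>exp (- m\<^sup>2 / 2)\<close> and the weight integrates over the whole line to \<open>sqrt (2 * pi)\<close>, up to
the same factor.  The remaining integral measures how far the cross term is from vanishing; it is
what decides the case of equality.
\<close>

lemma integral_pos_except_gauss_weight:
  fixes G :: "real ^ 'n ^ 'n"
  assumes G: "sym_pos_def G" and diag: "G $ i $ i = 1"
  shows "(\<integral>x. indicator (pos_except i) x * gauss_weight G x \<partial>lborel)
    = sqrt (2 * pi) * orthant_integral G (\<lambda>x. (G *v x) $ i)
      + (\<integral>x. indicator (pos_except i) x * ((1 - exp (- (cross_term G i x)\<^sup>2 / 2)) * gauss_weight G x) \<partial>lborel)"
proof -
  let ?e = "\<lambda>x. exp (- (cross_term G i x)\<^sup>2 / 2) * gauss_weight G x"
  let ?\<phi> = "\<lambda>x. indicator (pos_except i) x * ?e x"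
  let ?\<psi> = "\<lambda>x. indicator pos_orthant x * ((G *v x) $ i * gauss_weight G x)"
  have int_e: "integrable lborel ?e"
  proof (rule Bochner_Integration.integrable_bound[OF integrable_gauss_weight[OF G]])
    show "AE x in lborel. norm (?e x) \<le> norm (gauss_weight G x)"
      by (auto simp: abs_mult intro!: mult_left_le_one_le)
  qed measurable
  have int_\<phi>: "integrable lborel ?\<phi>"
    by (intro integrable_indicator_times int_e) auto
  have int_\<psi>: "integrable lborel ?\<psi>"
    by (intro integrable_indicator_times integrable_gradient_gauss_weight G) auto
  have "(\<integral>x. ?\<phi> x - sqrt (2 * pi) * ?\<psi> x \<partial>lborel) = 0"
  proof (rule integral_zero_if_line_integrals_zero)
    show "integrable lborel (\<lambda>x. ?\<phi> x - sqrt (2 * pi) * ?\<psi> x)"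
      using int_\<phi> int_\<psi> by simp
    show "axis i (1::real) \<in> Basis" by simp
    fix x :: "real ^ 'n" assume "x \<bullet> axis i 1 = 0"
    then have xi: "x $ i = 0" by (simp add: inner_axis)
    \<comment> \<open>At the base point of the line the cross term is the whole of \<open>(G x)\<^sub>i\<close>.\<close>
    let ?m = "(G *v x) $ i"
    let ?C = "exp (?m\<^sup>2 / 2) * gauss_weight G x"
    have m: "cross_term G i x = ?m" using xi by (simp add: cross_term_def)
    show "(\<integral>s. ?\<phi> (x + s *\<^sub>R axis i 1) - sqrt (2 * pi) * ?\<psi> (x + s *\<^sub>R axis i 1) \<partial>lborel) = 0"
    proof (cases "x \<in> pos_except i")
      case True
      have "(\<integral>s. ?\<phi> (x + s *\<^sub>R axis i 1) - sqrt (2 * pi) * ?\<psi> (x + s *\<^sub>R axis i 1) \<partial>lborel)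
        = (\<integral>s. (?C * exp (- ?m\<^sup>2 / 2)) * exp (- (?m + s)\<^sup>2 / 2)
            - (sqrt (2 * pi) * ?C) * (indicator {0<..} s * ((?m + s) * exp (- (?m + s)\<^sup>2 / 2))) \<partial>lborel)"
        unfolding gauss_weight_line[OF G diag] cross_term_line[OF G diag] quadratic_form_line(1)[OF G diag] m
        using True
        by (intro Bochner_Integration.integral_cong)
           (simp_all add: indicator_def pos_orthant_line[OF xi] pos_except_line algebra_simps)
      also have "\<dots> = (?C * exp (- ?m\<^sup>2 / 2)) * sqrt (2 * pi) - (sqrt (2 * pi) * ?C) * exp (- ?m\<^sup>2 / 2)"
        using lborel_integrable_real_affine[OF integrable_gauss, of 1 ?m]
        by (subst Bochner_Integration.integral_diff)
           (auto simp only: integral_mult_right_zero integral_gauss_shift integral_gauss_moment_half_line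
             mult_1 intro!: integrable_mult_right integrable_gauss_moment_half_line)
      finally show ?thesis by simp
    qed (simp add: indicator_def pos_orthant_line[OF xi] pos_except_line)
  qed
  then have "(\<integral>x. ?\<phi> x \<partial>lborel) = sqrt (2 * pi) * orthant_integral G (\<lambda>x. (G *v x) $ i)"
    using int_\<phi> int_\<psi> by (simp add: orthant_integral_def)
  moreover have "(\<integral>x. indicator (pos_except i) x * ((1 - exp (- (cross_term G i x)\<^sup>2 / 2)) * gauss_weight G x) \<partial>lborel)
    = (\<integral>x. indicator (pos_except i) x * gauss_weight G x \<partial>lborel) - (\<integral>x. ?\<phi> x \<partial>lborel)"
    using integrable_indicator_times[OF integrable_gauss_weight[OF G], of "pos_except i"] int_\<phi>
    by (subst Bochner_Integration.integral_diff[symmetric]) (auto simp: algebra_simps)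
  ultimately show ?thesis by simp
qed

lemma integrable_cross_term_defect:
  fixes G :: "real ^ 'n ^ 'n"
  assumes G: "sym_pos_def G"
  shows "integrable lborel (\<lambda>x. indicator (pos_except i) x * ((1 - exp (- (cross_term G i x)\<^sup>2 / 2)) * gauss_weight G x))"
proof (rule Bochner_Integration.integrable_bound[OF integrable_gauss_weight[OF G]])
  show "AE x in lborel. norm (indicator (pos_except i) x * ((1 - exp (- (cross_term G i x)\<^sup>2 / 2)) * gauss_weight G x)) \<le> norm (gauss_weight G x)"
    by (auto simp: abs_mult intro!: mult_left_le_one_le split: split_indicator)
qed measurable

text \<open>
On each line in direction \<open>i\<close> the integrals of \<open>(G x)\<^sub>i\<close>, of one, and of the cross term
\<open>(G x)\<^sub>i - x\<^sub>i\<close> against the weight are proportional to \<open>exp (- m\<^sup>2 / 2)\<close>, to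
\<open>gauss_tail m\<close>, and to \<open>m * gauss_tail m\<close>, where \<open>m\<close> is the cross term.  So a pointwise
inequality between these functions of \<open>m\<close> gives one between the integrals.
\<close>

lemma orthant_integral_combination_nonneg:
  fixes G :: "real ^ 'n ^ 'n"
  assumes G: "sym_pos_def G" and diag: "G $ i $ i = 1"
    and le: "\<And>x. x \<in> pos_except i \<Longrightarrow>
      0 \<le> p * exp (- (cross_term G i x)\<^sup>2 / 2) + (q + r * cross_term G i x) * gauss_tail (cross_term G i x)"
  shows "0 \<le> p * orthant_integral G (\<lambda>x. (G *v x) $ i) + q * orthant_integral G (\<lambda>_. 1)
      + r * (orthant_integral G (\<lambda>x. (G *v x) $ i) - orthant_integral G (\<lambda>x. x $ i))"
proof -
  let ?K = "\<lambda>x. indicator pos_orthant x :: real"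
  let ?f = "\<lambda>x. ?K x * ((p * (G *v x) $ i + q + r * cross_term G i x) * gauss_weight G x)"
  have int: "integrable lborel (\<lambda>x. ?K x * (1 * gauss_weight G x))"
    "integrable lborel (\<lambda>x. ?K x * ((G *v x) $ i * gauss_weight G x))"
    "integrable lborel (\<lambda>x. ?K x * (x $ i * gauss_weight G x))"
    using integrable_gauss_weight[OF G]
    by (auto intro!: integrable_indicator_times integrable_gradient_gauss_weight
        integrable_component_gauss_weight G)
  have f: "?f = (\<lambda>x. p * (?K x * ((G *v x) $ i * gauss_weight G x)) + q * (?K x * (1 * gauss_weight G x))
      + r * (?K x * ((G *v x) $ i * gauss_weight G x) - ?K x * (x $ i * gauss_weight G x)))"
    by (simp add: cross_term_def algebra_simps fun_eq_iff)
  have "0 \<le> (\<integral>x. ?f x \<partial>lborel)"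
  proof (rule integral_nonneg_if_line_integrals_nonneg)
    show "integrable lborel ?f" unfolding f using int by simp
    show "axis i (1::real) \<in> Basis" by simp
    fix x :: "real ^ 'n" assume "x \<bullet> axis i 1 = 0"
    then have xi: "x $ i = 0" by (simp add: inner_axis)
    let ?m = "(G *v x) $ i"
    let ?C = "exp (?m\<^sup>2 / 2) * gauss_weight G x"
    have m: "cross_term G i x = ?m" using xi by (simp add: cross_term_def)
    show "0 \<le> (\<integral>s. ?f (x + s *\<^sub>R axis i 1) \<partial>lborel)"
    proof (cases "x \<in> pos_except i")
      case True
      have "(\<integral>s. ?f (x + s *\<^sub>R axis i 1) \<partial>lborel)
        = (\<integral>s. ?C * (p * (indicator {0<..} s * ((?m + s) * exp (- (?m + s)\<^sup>2 / 2)))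
            + (q + r * ?m) * (indicator {0<..} s * exp (- (?m + s)\<^sup>2 / 2))) \<partial>lborel)"
        unfolding gauss_weight_line[OF G diag] cross_term_line[OF G diag] quadratic_form_line(1)[OF G diag] m
        using True
        by (intro Bochner_Integration.integral_cong)
           (simp_all add: indicator_def pos_orthant_line[OF xi] algebra_simps)
      also have "\<dots> = ?C * (p * exp (- ?m\<^sup>2 / 2) + (q + r * ?m) * gauss_tail ?m)"
        unfolding integral_mult_right_zero
        by (subst Bochner_Integration.integral_add)
           (auto simp only: integral_mult_right_zero integral_gauss_half_line integral_gauss_moment_half_line
             intro!: integrable_mult_right integrable_gauss_half_line integrable_gauss_moment_half_line)
      also have "0 \<le> \<dots>"
        using le[OF True] unfolding m by (intro mult_nonneg_nonneg) (auto simp: less_imp_le)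
      finally show ?thesis .
    qed (simp add: indicator_def pos_orthant_line[OF xi])
  qed
  also have "(\<integral>x. ?f x \<partial>lborel) = p * orthant_integral G (\<lambda>x. (G *v x) $ i) + q * orthant_integral G (\<lambda>_. 1)
      + r * (orthant_integral G (\<lambda>x. (G *v x) $ i) - orthant_integral G (\<lambda>x. x $ i))"
    unfolding f orthant_integral_def using int by simp
  finally show ?thesis .
qed

section \<open>Tails of a coordinate\<close>

text \<open>
The parallelogram law for the quadratic form, with the square of the difference dropped.
\<close>

lemma gauss_weight_midpoint:
  assumes G: "sym_pos_def G"
  shows "gauss_weight G x * gauss_weight G y \<le> (gauss_weight G ((1/2) *\<^sub>R (x + y)))\<^sup>2"
proof -
  have "0 \<le> (G *v (x - y)) \<bullet> (x - y)" by (rule sym_pos_def_nonneg[OF G])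
  then have "2 * ((G *v x) \<bullet> y) \<le> (G *v x) \<bullet> x + (G *v y) \<bullet> y"
    using sym_pos_def_inner_commute[OF G, of x y]
    by (simp add: matrix_vector_mult_diff_distrib inner_diff_left inner_diff_right)
  then have "(G *v ((1/2) *\<^sub>R (x + y))) \<bullet> ((1/2) *\<^sub>R (x + y)) \<le> ((G *v x) \<bullet> x + (G *v y) \<bullet> y) / 2"
    using sym_pos_def_inner_commute[OF G, of x y]
    by (simp add: matrix_vector_right_distrib matrix_vector_mult_scaleR inner_add_left inner_add_right
        field_simps)
  then show ?thesis
    unfolding gauss_weight_def power2_eq_square exp_add[symmetric] by (simp add: add_divide_distrib[symmetric])
qed

definition tail_mass :: "real ^ 'n ^ 'n \<Rightarrow> 'n \<Rightarrow> real \<Rightarrow> real" where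
  "tail_mass G i s = (\<integral>x. indicator {x \<in> pos_orthant. s < x $ i} x * gauss_weight G x \<partial>lborel)"

lemma tail_set_borel [measurable]: "{x :: real ^ 'n. x \<in> pos_orthant \<and> s < x $ i} \<in> sets borel"
proof -
  have "{x :: real ^ 'n. x \<in> pos_orthant \<and> s < x $ i} = pos_orthant \<inter> {x. s < x $ i}" by auto
  also have "open \<dots>" by (intro open_Int open_pos_orthant open_Collect_less continuous_intros)
  finally show ?thesis by simp
qed

lemma tail_mass_nonneg: "0 \<le> tail_mass G i s"
  unfolding tail_mass_def by (intro Bochner_Integration.integral_nonneg) (auto simp: less_imp_le)

lemma tail_mass_0: "tail_mass G i 0 = orthant_integral G (\<lambda>_. 1)"
  unfolding tail_mass_def orthant_integral_def
  by (intro Bochner_Integration.integral_cong) (auto simp: pos_orthant_def split: split_indicator)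

lemma nn_integral_tail_mass:
  fixes G :: "real ^ 'n ^ 'n"
  assumes "sym_pos_def G"
  shows "(\<integral>\<^sup>+x. ennreal (indicator {x \<in> pos_orthant. s < x $ i} x * gauss_weight G x) \<partial>lborel)
    = ennreal (tail_mass G i s)"
  unfolding tail_mass_def
  by (rule nn_integral_eq_integral)
     (auto intro!: integrable_indicator_times integrable_gauss_weight assms simp: less_imp_le)

text \<open>
The Prekopa-Leindler inequality applies: the midpoint of a point with \<open>x\<^sub>i > 2 s\<close> and a point of
the orthant has \<open>x\<^sub>i > s\<close>, and the weight is log-concave.
\<close>

lemma tail_mass_midpoint:
  fixes G :: "real ^ 'n ^ 'n"
  assumes G: "sym_pos_def G"
  shows "tail_mass G i (2 * s) * tail_mass G i 0 \<le> (tail_mass G i s)\<^sup>2"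
proof -
  let ?f = "\<lambda>s x. ennreal (indicator {x \<in> pos_orthant. s < x $ i} x * gauss_weight G x)"
  have "(\<integral>\<^sup>+x. ?f (2 * s) x \<partial>lborel) * (\<integral>\<^sup>+x. ?f 0 x \<partial>lborel) \<le> (\<integral>\<^sup>+x. ?f s x \<partial>lborel)\<^sup>2"
  proof (rule prekopa_leindler_midpoint)
    fix x y :: "real ^ 'n"
    let ?z = "(1/2) *\<^sub>R (x + y)"
    show "?f (2 * s) x * ?f 0 y \<le> (?f s ?z)\<^sup>2"
    proof (cases "x \<in> {x \<in> pos_orthant. 2 * s < x $ i} \<and> y \<in> {x \<in> pos_orthant. 0 < x $ i}")
      case True
      then have "?z \<in> {x \<in> pos_orthant. s < x $ i}"
        by (auto simp: pos_orthant_def add_pos_pos)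
      then show ?thesis
        using True gauss_weight_midpoint[OF G, of x y]
        by (simp add: ennreal_mult[symmetric] power2_eq_square less_imp_le ennreal_leI)
    qed (auto split: split_indicator)
  qed measurable
  then show ?thesis
    unfolding nn_integral_tail_mass[OF G]
    by (simp add: ennreal_mult[symmetric] tail_mass_nonneg power2_eq_square)
qed

lemma exp_gradient_gauss_weight:
  fixes G :: "real ^ 'n ^ 'n"
  assumes "sym_pos_def G" "G $ i $ i = 1"
  shows "exp (- s * (G *v x) $ i) * gauss_weight G x = exp (s\<^sup>2 / 2) * gauss_weight G (s *\<^sub>R axis i 1 + x)"
proof -
  have "gauss_weight G (s *\<^sub>R axis i 1 + x)
      = exp (((G *v x) $ i)\<^sup>2 / 2) * gauss_weight G x * exp (- ((G *v x) $ i + s)\<^sup>2 / 2)"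
    using gauss_weight_line[OF assms, of x s] by (simp add: add.commute)
  moreover have "exp (- s * (G *v x) $ i)
      = exp (s\<^sup>2 / 2) * (exp (((G *v x) $ i)\<^sup>2 / 2) * exp (- ((G *v x) $ i + s)\<^sup>2 / 2))"
    unfolding exp_add[symmetric] by (rule arg_cong[of _ _ exp]) (simp add: power2_eq_square field_simps)
  ultimately show ?thesis by simp
qed

lemma integrable_exp_gradient:
  fixes G :: "real ^ 'n ^ 'n"
  assumes "sym_pos_def G" "G $ i $ i = 1"
  shows "integrable lborel (\<lambda>x. exp (- s * (G *v x) $ i) * gauss_weight G x)"
  unfolding exp_gradient_gauss_weight[OF assms]
  by (intro integrable_mult_right integrable_lborel_translate integrable_gauss_weight assms)

text \<open>
Translating by \<open>s\<close> in direction \<open>i\<close> maps the orthant onto the part with \<open>x\<^sub>i > s\<close>.  This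
makes the domain independent of \<open>s\<close>, so that the tail can be differentiated at zero under the
integral sign.
\<close>

lemma tail_mass_le_exp_moment:
  fixes G :: "real ^ 'n ^ 'n"
  assumes G: "sym_pos_def G" "G $ i $ i = 1" and "0 \<le> s"
  shows "tail_mass G i s \<le> orthant_integral G (\<lambda>x. exp (- s * (G *v x) $ i))"
proof -
  let ?f = "\<lambda>x. indicator {x \<in> pos_orthant. s < x $ i} x * gauss_weight G x"
  have "tail_mass G i s = (\<integral>x. ?f (s *\<^sub>R axis i 1 + x) \<partial>lborel)"
    unfolding tail_mass_def by (rule integral_lborel_translate[symmetric]) measurable
  also have "\<dots> \<le> orthant_integral G (\<lambda>x. exp (- s * (G *v x) $ i))"
    unfolding orthant_integral_def
  proof (rule integral_mono)
    show "integrable lborel (\<lambda>x. ?f (s *\<^sub>R axis i 1 + x))"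
      by (intro integrable_lborel_translate integrable_indicator_times integrable_gauss_weight G)
        measurable
    show "integrable lborel (\<lambda>x. indicator pos_orthant x * (exp (- s * (G *v x) $ i) * gauss_weight G x))"
      by (intro integrable_indicator_times integrable_exp_gradient G) auto
    fix x :: "real ^ 'n"
    have shift: "(s *\<^sub>R axis i 1 + x) $ j = (if j = i then s + x $ i else x $ j)" for j
      by (simp add: axis_def)
    have "indicator {x \<in> pos_orthant. s < x $ i} (s *\<^sub>R axis i 1 + x) \<le> (indicator pos_orthant x :: real)"
      unfolding indicator_def pos_orthant_def mem_Collect_eq shift by auto
    moreover have "gauss_weight G (s *\<^sub>R axis i 1 + x) \<le> exp (s\<^sup>2 / 2) * gauss_weight G (s *\<^sub>R axis i 1 + x)"
      by (simp add: less_imp_le)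
    ultimately show "?f (s *\<^sub>R axis i 1 + x) \<le> indicator pos_orthant x * (exp (- s * (G *v x) $ i) * gauss_weight G x)"
      unfolding exp_gradient_gauss_weight[OF G] by (intro mult_mono) (auto simp: less_imp_le)
  qed
  finally show ?thesis .
qed

text \<open>
An integrable bound, uniform in \<open>N\<close>, for the difference quotients of \<open>exp (- r v)\<close> at \<open>r = 0\<close>;
the upper estimate is Bernoulli's inequality.
\<close>

lemma abs_scaled_exp_difference_le:
  fixes v :: real
  assumes "0 < N"
  shows "\<bar>real N * (exp (- v / real N) - 1)\<bar> \<le> \<bar>v\<bar> + exp (- v)"
proof -
  let ?A = "real N * (exp (- v / real N) - 1)"
  have "1 + - v / real N \<le> exp (- v / real N)" by (rule exp_ge_add_one_self)
  then have lower: "- v \<le> ?A" using assms by (simp add: field_simps)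
  have "1 + ?A \<le> (1 + (exp (- v / real N) - 1)) ^ N"
    by (rule Bernoulli_inequality) simp
  also have "\<dots> = exp (- v)" using assms by (simp add: exp_of_nat_mult[symmetric])
  finally have upper: "?A \<le> exp (- v)" by simp
  have "\<bar>A\<bar> \<le> \<bar>v\<bar> + e" if "- v \<le> A" "A \<le> e" "0 < e" for A e
    using that by linarith
  from this[OF lower upper exp_gt_zero] show ?thesis .
qed

text \<open>
The slope at zero of the exponential moments, along the dyadic steps of the iteration in the next
proof; it turns the mean of \<open>(G x)\<^sub>i\<close> into a decay rate.
\<close>

lemma exp_moment_derivative:
  fixes G :: "real ^ 'n ^ 'n"
  assumes G: "sym_pos_def G" "G $ i $ i = 1"
  shows "(\<lambda>n. 2 ^ n * (orthant_integral G (\<lambda>x. exp (- (s / 2 ^ n) * (G *v x) $ i)) - orthant_integral G (\<lambda>_. 1)))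
    \<longlonglongrightarrow> - s * orthant_integral G (\<lambda>x. (G *v x) $ i)"
proof -
  let ?K = "\<lambda>x. indicator pos_orthant x :: real"
  let ?u = "\<lambda>x. (G *v x) $ i"
  have int: "integrable lborel (\<lambda>x. ?K x * (1 * gauss_weight G x))"
    "integrable lborel (\<lambda>x. ?K x * (?u x * gauss_weight G x))"
    using integrable_gauss_weight[OF G(1)]
    by (auto intro!: integrable_indicator_times integrable_gradient_gauss_weight G)
  have int_exp: "integrable lborel (\<lambda>x. ?K x * (exp (- r * ?u x) * gauss_weight G x))" for r
    by (intro integrable_indicator_times integrable_exp_gradient G) simp
  let ?d = "\<lambda>n x. ?K x * ((2 ^ n * (exp (- (s * ?u x) / 2 ^ n) - 1)) * gauss_weight G x)"
  have d_eq: "?d n = (\<lambda>x. 2 ^ n * (?K x * (exp (- (s / 2 ^ n) * ?u x) * gauss_weight G x) - ?K x * (1 * gauss_weight G x)))" for n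
    by (simp add: fun_eq_iff algebra_simps)
  have int_d: "(\<integral>x. ?d n x \<partial>lborel)
      = 2 ^ n * (orthant_integral G (\<lambda>x. exp (- (s / 2 ^ n) * ?u x)) - orthant_integral G (\<lambda>_. 1))" for n
    unfolding d_eq orthant_integral_def integral_mult_right_zero
    by (subst Bochner_Integration.integral_diff) (use int(1) int_exp[of "s / 2 ^ n"] in auto)
  have "(\<lambda>n. \<integral>x. ?d n x \<partial>lborel) \<longlonglongrightarrow> (\<integral>x. - s * (?K x * (?u x * gauss_weight G x)) \<partial>lborel)"
  proof (rule integral_dominated_convergence)
    show "(\<lambda>x. - s * (?K x * (?u x * gauss_weight G x))) \<in> borel_measurable lborel"
      using int(2) by (intro borel_measurable_integrable) simp
    show "?d n \<in> borel_measurable lborel" for n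
      unfolding d_eq using int(1) int_exp[of "s / 2 ^ n"] by (intro borel_measurable_integrable) simp
    show "integrable lborel (\<lambda>x. \<bar>s\<bar> * \<bar>?K x * (?u x * gauss_weight G x)\<bar> + ?K x * (exp (- s * ?u x) * gauss_weight G x))"
      by (intro Bochner_Integration.integrable_add integrable_mult_right integrable_abs int int_exp)
    have lim: "(\<lambda>n. 2 ^ n * (exp (- v / 2 ^ n) - 1)) \<longlonglongrightarrow> - v" for v :: real
      by real_asymp
    show "AE x in lborel. (\<lambda>n. ?d n x) \<longlonglongrightarrow> - s * (?K x * (?u x * gauss_weight G x))"
    proof (rule AE_I2)
      fix x
      have "(\<lambda>n. ?d n x) \<longlonglongrightarrow> ?K x * (- (s * ?u x) * gauss_weight G x)"
        by (intro tendsto_intros lim)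
      then show "(\<lambda>n. ?d n x) \<longlonglongrightarrow> - s * (?K x * (?u x * gauss_weight G x))"
        by (simp add: ac_simps)
    qed
    show "AE x in lborel. norm (?d n x) \<le> \<bar>s\<bar> * \<bar>?K x * (?u x * gauss_weight G x)\<bar> + ?K x * (exp (- s * ?u x) * gauss_weight G x)" for n
    proof (rule AE_I2)
      fix x
      have "\<bar>2 ^ n * (exp (- (s * ?u x) / 2 ^ n) - 1)\<bar> \<le> \<bar>s * ?u x\<bar> + exp (- (s * ?u x))"
        using abs_scaled_exp_difference_le[of "2 ^ n" "s * ?u x"] by simp
      then have "?K x * (\<bar>2 ^ n * (exp (- (s * ?u x) / 2 ^ n) - 1)\<bar> * gauss_weight G x)
          \<le> ?K x * ((\<bar>s * ?u x\<bar> + exp (- (s * ?u x))) * gauss_weight G x)"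
        by (intro mult_left_mono mult_right_mono) (auto simp: less_imp_le)
      also have "\<dots> = \<bar>s\<bar> * \<bar>?K x * (?u x * gauss_weight G x)\<bar> + ?K x * (exp (- s * ?u x) * gauss_weight G x)"
        by (cases "x \<in> pos_orthant") (simp_all add: abs_mult abs_of_pos algebra_simps)
      finally show "norm (?d n x) \<le> \<bar>s\<bar> * \<bar>?K x * (?u x * gauss_weight G x)\<bar> + ?K x * (exp (- s * ?u x) * gauss_weight G x)"
        by (simp only: real_norm_def abs_mult abs_indicator abs_of_pos[OF gauss_weight_pos])
    qed
  qed
  then show ?thesis unfolding int_d integral_mult_right_zero orthant_integral_def .
qed

text \<open>
The midpoint inequality reads \<open>F (2 s) \<le> (F s)\<^sup>2\<close> for the tail function \<open>F\<close> normalised to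
\<open>F 0 = 1\<close>.  Iterating it towards zero bounds \<open>F s\<close> by \<open>(F (s / 2 ^ n)) ^ (2 ^ n)\<close>, whose limit is
determined by the slope of \<open>F\<close> at zero.
\<close>

lemma tail_mass_le_exp:
  fixes G :: "real ^ 'n ^ 'n"
  assumes G: "sym_pos_def G" "G $ i $ i = 1" and "0 \<le> s"
  defines "a \<equiv> orthant_integral G (\<lambda>_. 1)" and "J \<equiv> orthant_integral G (\<lambda>x. (G *v x) $ i)"
  shows "tail_mass G i s \<le> a * exp (- s * J / a)"
proof -
  have a: "0 < a" unfolding a_def by (rule orthant_integral_one_pos[OF G(1)])
  define F where "F s = tail_mass G i s / a" for s
  have F_nonneg: "0 \<le> F s" for s using a by (simp add: F_def tail_mass_nonneg)
  have double: "F (2 * s) \<le> (F s)\<^sup>2" for s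
    using tail_mass_midpoint[OF G(1), of i s] a
    by (simp add: F_def tail_mass_0 a_def[symmetric] power_divide power2_eq_square field_simps)
  have iterate: "F s \<le> (F (s / 2 ^ n)) ^ (2 ^ n)" for n
  proof (induction n)
    case (Suc n)
    have "F s \<le> (F (s / 2 ^ n)) ^ (2 ^ n)" by (rule Suc)
    also have "\<dots> \<le> ((F (s / 2 ^ Suc n))\<^sup>2) ^ (2 ^ n)"
      using double[of "s / 2 ^ Suc n"] by (intro power_mono F_nonneg) simp
    finally show ?case by (simp add: power_mult[symmetric])
  qed simp
  let ?E = "\<lambda>r. orthant_integral G (\<lambda>x. exp (- r * (G *v x) $ i))"
  have bound: "F s \<le> exp ((2 ^ n * (?E (s / 2 ^ n) - a)) / a)" for n
  proof -
    let ?r = "s / 2 ^ n"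
    have "F ?r \<le> exp (F ?r - 1)" using exp_ge_add_one_self[of "F ?r - 1"] by simp
    also have "\<dots> \<le> exp ((?E ?r - a) / a)"
      using tail_mass_le_exp_moment[OF G, of ?r] \<open>0 \<le> s\<close> a by (simp add: F_def field_simps)
    finally have "(F ?r) ^ (2 ^ n) \<le> (exp ((?E ?r - a) / a)) ^ (2 ^ n)"
      by (intro power_mono F_nonneg)
    also have "\<dots> = exp ((2 ^ n * (?E ?r - a)) / a)" by (simp add: exp_of_nat_mult[symmetric])
    finally show ?thesis using iterate[of n] by simp
  qed
  have "(\<lambda>n. exp ((2 ^ n * (?E (s / 2 ^ n) - a)) / a)) \<longlonglongrightarrow> exp (- s * J / a)"
    unfolding a_def J_def using a by (intro tendsto_intros exp_moment_derivative G) (simp add: a_def)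
  then have "F s \<le> exp (- s * J / a)"
    by (rule LIMSEQ_le_const) (use bound in blast)
  then show ?thesis using a by (simp add: F_def field_simps)
qed

text \<open>
In normalised form, \<open>\<mu>\<^sub>i b\<^sub>i \<le> 1\<close>.  The mean of a positive variable is the integral of its tail
function, and the tail function is at most \<open>exp (- b\<^sub>i s)\<close>.
\<close>

lemma orthant_mean_times_boundary_density_le:
  fixes G :: "real ^ 'n ^ 'n"
  assumes G: "sym_pos_def G" "G $ i $ i = 1"
  shows "orthant_integral G (\<lambda>x. x $ i) * orthant_integral G (\<lambda>x. (G *v x) $ i)
    \<le> (orthant_integral G (\<lambda>_. 1))\<^sup>2"
proof -
  define a where "a = orthant_integral G (\<lambda>_. 1)"
  define J where "J = orthant_integral G (\<lambda>x. (G *v x) $ i)"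
  define M where "M = orthant_integral G (\<lambda>x. x $ i)"
  have a: "0 < a" unfolding a_def by (rule orthant_integral_one_pos[OF G(1)])
  have M: "0 \<le> M" unfolding M_def by (rule orthant_integral_component_nonneg)
  have "M * J \<le> a\<^sup>2"
  proof (cases "0 < J")
    case False
    then have "M * J \<le> 0" using M by (simp add: mult_nonneg_nonpos)
    then show ?thesis using zero_le_power2[of a] by linarith
  next
    case True
    let ?g = "\<lambda>s x. ennreal (indicator {x \<in> pos_orthant. s < x $ i} x * gauss_weight G x)"
    \<comment> \<open>Write \<open>x\<^sub>i\<close> as the length of \<open>[0, x\<^sub>i)\<close> and exchange the integrals.\<close>
    have "ennreal M = (\<integral>\<^sup>+x. ennreal (indicator pos_orthant x * (x $ i * gauss_weight G x)) \<partial>lborel)"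
      unfolding M_def orthant_integral_def
      by (rule nn_integral_eq_integral[symmetric])
         (auto intro!: integrable_indicator_times integrable_component_gauss_weight G
           simp: pos_orthant_def less_imp_le split: split_indicator)
    also have "\<dots> = (\<integral>\<^sup>+x. (\<integral>\<^sup>+s. indicator {0..} s * ?g s x \<partial>lborel) \<partial>lborel)"
    proof (intro nn_integral_cong)
      fix x :: "real ^ 'n"
      show "ennreal (indicator pos_orthant x * (x $ i * gauss_weight G x)) = (\<integral>\<^sup>+s. indicator {0..} s * ?g s x \<partial>lborel)"
      proof (cases "x \<in> pos_orthant")
        case True
        then have "0 < x $ i" by (simp add: pos_orthant_def)
        have "(\<integral>\<^sup>+s. indicator {0..} s * ?g s x \<partial>lborel) = (\<integral>\<^sup>+s. ennreal (gauss_weight G x) * indicator {0..<x $ i} s \<partial>lborel)"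
          using True by (intro nn_integral_cong) (auto split: split_indicator)
        also have "\<dots> = ennreal (gauss_weight G x) * ennreal (x $ i)"
          using \<open>0 < x $ i\<close> by (simp add: nn_integral_cmult)
        finally show ?thesis using True \<open>0 < x $ i\<close> by (simp add: ennreal_mult[symmetric] less_imp_le mult.commute)
      qed simp
    qed
    also have "\<dots> = (\<integral>\<^sup>+s. (\<integral>\<^sup>+x. indicator {0..} s * ?g s x \<partial>lborel) \<partial>lborel)"
    proof (rule lborel_pair.Fubini')
      let ?S = "(UNIV \<times> pos_orthant) \<inter> {p :: real \<times> (real ^ 'n). fst p < snd p $ i}"
      have "open ?S"
        by (intro open_Int open_Times open_UNIV open_pos_orthant open_Collect_less continuous_intros)
      then have "?S \<in> sets borel" by simp
      then have [measurable]: "?S \<in> sets (borel \<Otimes>\<^sub>M borel)" by (simp only: borel_prod)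
      have "(\<lambda>p. indicator {0..} (fst p) * ennreal (indicator ?S p * gauss_weight G (snd p)))
          \<in> borel_measurable (lborel \<Otimes>\<^sub>M lborel)"
        by measurable
      also have "(\<lambda>p. indicator {0..} (fst p) * ennreal (indicator ?S p * gauss_weight G (snd p)))
          = (\<lambda>(s, x). indicator {0..} s * ?g s x)"
        by (auto simp: fun_eq_iff split: split_indicator)
      finally show "(\<lambda>(s, x). indicator {0..} s * ?g s x) \<in> borel_measurable (lborel \<Otimes>\<^sub>M lborel)" .
    qed
    also have "\<dots> = (\<integral>\<^sup>+s. ennreal (tail_mass G i s) * indicator {0..} s \<partial>lborel)"
    proof (intro nn_integral_cong)
      fix s :: real
      have "(\<integral>\<^sup>+x. indicator {0..} s * ?g s x \<partial>lborel) = indicator {0..} s * (\<integral>\<^sup>+x. ?g s x \<partial>lborel)"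
        by (rule nn_integral_cmult) measurable
      then show "(\<integral>\<^sup>+x. indicator {0..} s * ?g s x \<partial>lborel) = ennreal (tail_mass G i s) * indicator {0..} s"
        unfolding nn_integral_tail_mass[OF G(1)] by (simp only: mult.commute)
    qed
    also have "\<dots> \<le> (\<integral>\<^sup>+s. ennreal (a * exp (- s * J / a)) * indicator {0..} s \<partial>lborel)"
      using tail_mass_le_exp[OF G]
      by (intro nn_integral_mono) (auto simp: a_def J_def intro!: ennreal_leI split: split_indicator)
    also have "\<dots> = ennreal (0 - (- (a\<^sup>2 / J) * exp (- 0 * J / a)))"
    proof (rule nn_integral_FTC_atLeast)
      show "((\<lambda>s. - (a\<^sup>2 / J) * exp (- s * J / a)) has_real_derivative a * exp (- s * J / a)) (at s)" for s
        using a True by (auto intro!: derivative_eq_intros simp: power2_eq_square)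
      show "((\<lambda>s. - (a\<^sup>2 / J) * exp (- s * J / a)) \<longlongrightarrow> 0) at_top"
        using a True by real_asymp
    qed (use a in auto)
    finally have "M \<le> a\<^sup>2 / J" using True by simp
    then show ?thesis using True by (simp add: field_simps)
  qed
  then show ?thesis by (simp add: a_def J_def M_def)
qed

section \<open>The theorem\<close>

lemma sym_pos_def_invertible:
  assumes "sym_pos_def G"
  shows "invertible G"
proof -
  have "x = 0" if "G *v x = 0" for x
    using assms that unfolding sym_pos_def_def by (metis inner_zero_left less_irrefl)
  then show ?thesis
    unfolding invertible_left_inverse matrix_left_invertible_ker by blast
qed

text \<open>
Complete the square at the maximiser \<open>matrix_inv G *v 1\<close> of the left-hand side.
\<close>

lemma tval_variational:
  fixes G :: "real ^ 'n ^ 'n"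
  assumes G: "sym_pos_def G"
  shows "2 * (v \<bullet> 1) - (G *v v) \<bullet> v \<le> tval G"
proof -
  let ?y = "matrix_inv G *v 1"
  have y: "G *v ?y = 1"
    using someI_ex[OF sym_pos_def_invertible[OF G, unfolded invertible_def], folded matrix_inv_def] by (simp add: matrix_vector_mul_assoc)
  have "0 \<le> (G *v (?y - v)) \<bullet> (?y - v)" by (rule sym_pos_def_nonneg[OF G])
  also have "\<dots> = tval G - 2 * (v \<bullet> 1) + (G *v v) \<bullet> v"
    using sym_pos_def_inner_commute[OF G, of v ?y]
    by (simp add: matrix_vector_mult_diff_distrib y inner_diff_left inner_diff_right tval_def inner_commute)
  finally show ?thesis by simp
qed

lemma tval_mat_1: "tval (mat 1 :: real ^ 'n ^ 'n) = real CARD('n)"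
proof -
  have "invertible (mat 1 :: real ^ 'n ^ 'n)" by (auto simp: invertible_def)
  from someI_ex[OF this[unfolded invertible_def], folded matrix_inv_def]
  have "matrix_inv (mat 1 :: real ^ 'n ^ 'n) = mat 1" by simp
  then show ?thesis by (simp add: tval_def inner_vec_def)
qed

text \<open>
The normalising constant of the density cancels in the quotient.
\<close>

lemma Psi_eq:
  fixes G :: "real ^ 'n ^ 'n"
  assumes "sym_pos_def G"
  shows "Psi G = (\<Sum>i\<in>UNIV. (\<integral>x. indicator (pos_except i) x * gauss_weight G x \<partial>lborel)
    / orthant_integral G (\<lambda>_. 1))"
proof -
  define C where "C = sqrt (det G) / (2 * pi) powr (real CARD('n) / 2)"
  have "det G \<noteq> 0" using sym_pos_def_invertible[OF assms] by (simp add: invertible_det_nz)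
  then have C: "C \<noteq> 0" by (simp add: C_def)
  have density: "gauss_density G x = C * gauss_weight G x" for x
    by (simp add: gauss_density_def gauss_weight_def C_def)
  have "alpha G = C * orthant_integral G (\<lambda>_. 1)"
    unfolding alpha_def set_lebesgue_integral_def density orthant_integral_def integral_mult_right_zero[symmetric]
    by (simp add: ac_simps)
  moreover have "beta i G = C * (\<integral>x. indicator (pos_except i) x * gauss_weight G x \<partial>lborel)" for i
    unfolding beta_def set_lebesgue_integral_def density integral_mult_right_zero[symmetric]
    by (simp add: ac_simps)
  ultimately show ?thesis
    using C by (simp add: Psi_def sum_distrib_left[symmetric] sum_divide_distrib)
qed

text \<open>
Up to \<open>y = 2\<close> the coefficient \<open>2 (2 - y)\<close> of \<open>\<kappa> z\<close> is nonnegative, and the lower bound on \<open>z\<close>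
from \<open>1 + \<kappa> (y - z) \<le> y\<close> leaves a surplus of at least \<open>2 (1 - \<kappa>) (y - 1)\<^sup>2\<close>.  Beyond that the
coefficient is negative and an upper bound on \<open>z\<close> is needed instead, which \<open>\<kappa> z y \<le> 1\<close> provides.
\<close>

lemma coordinate_inequality:
  fixes \<kappa> y z :: real
  assumes \<kappa>: "0 < \<kappa>" "\<kappa> < 1"
    and tangent: "1 + \<kappa> * (y - z) \<le> y" and prod: "\<kappa> * (z * y) \<le> 1"
  shows "2 + 2 * \<kappa> \<le> 2 * y + 2 * \<kappa> * (2 * z - z * y)"
proof (cases "y \<le> 2")
  case True
  have "(2 - y) * (1 - (1 - \<kappa>) * y) \<le> (2 - y) * (\<kappa> * z)"
    using True tangent by (intro mult_left_mono) (auto simp: algebra_simps)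
  moreover have "0 \<le> (1 - \<kappa>) * (y - 1)\<^sup>2" using \<kappa> by simp
  ultimately show ?thesis by (simp add: power2_eq_square algebra_simps)
next
  case False
  then have "\<kappa> * z \<le> 1 / 2"
  proof -
    have "(\<kappa> * z) * y \<le> 1" using prod by (simp add: ac_simps)
    then have "\<kappa> * z \<le> 1 / y" using False by (simp add: field_simps)
    also have "\<dots> \<le> 1 / 2" using False by (simp add: field_simps)
    finally show ?thesis .
  qed
  then have "(\<kappa> * z) * (y - 2) \<le> 1 / 2 * (y - 2)" using False by (intro mult_right_mono) auto
  then show ?thesis using \<kappa> False by (simp add: algebra_simps)
qed

lemma coordinate_defect_nonneg:
  "0 \<le> (\<integral>x. indicator (pos_except i) x * ((1 - exp (- (cross_term G i x)\<^sup>2 / 2)) * gauss_weight G x) \<partial>lborel)"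
  by (intro Bochner_Integration.integral_nonneg) (auto simp: less_imp_le)

text \<open>
If the cross term were non-zero at some point of \<open>pos_except i\<close>, the integrand would be positive on
an open set.  So it vanishes there, in particular at two points that differ by the \<open>j\<close>-th unit
vector.
\<close>

lemma row_trivial_if_coordinate_defect_zero:
  fixes G :: "real ^ 'n ^ 'n"
  assumes G: "sym_pos_def G" and "j \<noteq> i"
    and zero: "(\<integral>x. indicator (pos_except i) x * ((1 - exp (- (cross_term G i x)\<^sup>2 / 2)) * gauss_weight G x) \<partial>lborel) = 0"
  shows "G $ i $ j = 0"
proof -
  have off: "cross_term G i x = 0" if x: "x \<in> pos_except i" for x
  proof (rule ccontr)
    assume "cross_term G i x \<noteq> 0"
    let ?U = "pos_except i \<inter> {x. cross_term G i x \<noteq> 0}"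
    have "0 < (\<integral>x. indicator (pos_except i) x * ((1 - exp (- (cross_term G i x)\<^sup>2 / 2)) * gauss_weight G x) \<partial>lborel)"
    proof (rule integral_pos_if_pos_on_open[where U = ?U])
      show "integrable lborel (\<lambda>x. indicator (pos_except i) x * ((1 - exp (- (cross_term G i x)\<^sup>2 / 2)) * gauss_weight G x))"
        by (rule integrable_cross_term_defect[OF G])
      have "cross_term G i = (\<lambda>x. ((*v) G x - x) $ i)" by (simp add: cross_term_def fun_eq_iff)
      then have "continuous_on UNIV (cross_term G i)"
        by (simp only:) (intro continuous_intros matrix_vector_mult_linear_continuous_on)
      then show "open ?U"
        by (intro open_Int open_pos_except open_Collect_neq continuous_intros) auto
      show "?U \<noteq> {}" using x \<open>cross_term G i x \<noteq> 0\<close> by blast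
    qed (auto simp: less_imp_le split: split_indicator)
    then show False using zero by simp
  qed
  have "(1 :: real ^ 'n) \<in> pos_except i" by (simp add: pos_except_def)
  moreover have "(1 :: real ^ 'n) + axis j 1 \<in> pos_except i"
    by (auto simp: pos_except_def axis_def)
  ultimately have "cross_term G i (1 + axis j 1) - cross_term G i 1 = 0" using off by simp
  then have "(G *v axis j 1) $ i = 0"
    using \<open>j \<noteq> i\<close> by (simp add: cross_term_def matrix_vector_right_distrib axis_def)
  then show ?thesis by (simp add: matrix_vector_mult_basis column_def)
qed

lemma sym_pos_def_mat_1: "sym_pos_def (mat 1 :: real ^ 'n ^ 'n)"
  by (simp add: sym_pos_def_def transpose_mat)

text \<open>
For the identity the cross terms vanish, and the inequality between the line integrals becomes an
equality, which is obtained by applying it with both signs.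
\<close>

lemma Psi_mat_1: "Psi (mat 1 :: real ^ 'n ^ 'n) = 2 * real CARD('n)"
proof -
  let ?I = "mat 1 :: real ^ 'n ^ 'n"
  let ?a = "orthant_integral ?I (\<lambda>_. 1)"
  have a: "0 < ?a" by (rule orthant_integral_one_pos[OF sym_pos_def_mat_1])
  have off: "cross_term ?I i x = 0" for i x by (simp add: cross_term_def)
  have "(\<integral>x. indicator (pos_except i) x * gauss_weight ?I x \<partial>lborel) / ?a = 2" for i
  proof -
    let ?J = "orthant_integral ?I (\<lambda>x. (?I *v x) $ i)"
    have diag: "?I $ i $ i = 1" by (simp add: mat_def)
    have "0 \<le> 1 * ?J + - half_normal_mean * ?a + 0 * (?J - orthant_integral ?I (\<lambda>x. x $ i))"
      by (rule orthant_integral_combination_nonneg[OF sym_pos_def_mat_1 diag])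
         (simp add: off gauss_tail_0 half_normal_mean_pos[THEN less_imp_neq, symmetric])
    moreover have "0 \<le> -1 * ?J + half_normal_mean * ?a + 0 * (?J - orthant_integral ?I (\<lambda>x. x $ i))"
      by (rule orthant_integral_combination_nonneg[OF sym_pos_def_mat_1 diag])
         (simp add: off gauss_tail_0 half_normal_mean_pos[THEN less_imp_neq, symmetric])
    ultimately have "?J = half_normal_mean * ?a" by simp
    then have "(\<integral>x. indicator (pos_except i) x * gauss_weight ?I x \<partial>lborel) = sqrt (2 * pi) * half_normal_mean * ?a"
      using integral_pos_except_gauss_weight[OF sym_pos_def_mat_1 diag] by (simp add: off)
    also have "sqrt (2 * pi) * half_normal_mean = 2"
      by (simp add: sqrt_2_pi_times_half_normal_mean)
    finally show ?thesis using a by simp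
  qed
  then show ?thesis unfolding Psi_eq[OF sym_pos_def_mat_1] by simp
qed

theorem theorem2p1:
  fixes G :: "real ^ 'n ^ 'n"
  assumes "sym_pos_def G"
    and "\<And>i. G $ i $ i = 1"
  shows "Psi G + 4 / pi * tval G \<ge> (2 + 4 / pi) * real CARD('n) \<and>
    (Psi G + 4 / pi * tval G = (2 + 4 / pi) * real CARD('n) \<longleftrightarrow> G = mat 1)"
proof -
  note G = assms(1) and diag = assms(2)
  define k where "k = half_normal_mean"
  define a where "a = orthant_integral G (\<lambda>_. 1)"
  \<comment> \<open>For the identity matrix this scaling makes \<open>y\<close> and \<open>z\<close> constantly one; in general
    \<open>y = G z\<close>.\<close>
  define y z D where "y i = orthant_integral G (\<lambda>x. (G *v x) $ i) / (a * k)"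
    and "z i = orthant_integral G (\<lambda>x. x $ i) / (a * k)"
    and "D i = (\<integral>x. indicator (pos_except i) x * ((1 - exp (- (cross_term G i x)\<^sup>2 / 2)) * gauss_weight G x) \<partial>lborel) / a"
    for i
  have a: "0 < a" unfolding a_def by (rule orthant_integral_one_pos[OF G])
  have k: "0 < k" "0 < k\<^sup>2" "k\<^sup>2 < 1" "2 * k\<^sup>2 = 4 / pi"
    using half_normal_mean_sq_bounds by (simp_all add: k_def half_normal_mean_sq)
  have J: "orthant_integral G (\<lambda>x. (G *v x) $ i) = a * k * y i"
    and M: "orthant_integral G (\<lambda>x. x $ i) = a * k * z i" for i
    using a k by (simp_all add: y_def z_def)
  have D_nonneg: "0 \<le> D i" for i
    using coordinate_defect_nonneg[of i G] a by (simp add: D_def)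
  have coord: "2 + 2 * k\<^sup>2 + D i
      \<le> (\<integral>x. indicator (pos_except i) x * gauss_weight G x \<partial>lborel) / a + 2 * k\<^sup>2 * (2 * z i - z i * y i)" for i
  proof -
    have "(\<integral>x. indicator (pos_except i) x * gauss_weight G x \<partial>lborel) = a * ((sqrt (2 * pi) * k) * y i + D i)"
      unfolding integral_pos_except_gauss_weight[OF G diag] J using a by (simp add: D_def algebra_simps)
    then have beta: "(\<integral>x. indicator (pos_except i) x * gauss_weight G x \<partial>lborel) / a = 2 * y i + D i"
      using a by (simp add: k_def sqrt_2_pi_times_half_normal_mean)
    have "0 \<le> 1 * orthant_integral G (\<lambda>x. (G *v x) $ i) + - k * orthant_integral G (\<lambda>_. 1)
        + - k\<^sup>2 * (orthant_integral G (\<lambda>x. (G *v x) $ i) - orthant_integral G (\<lambda>x. x $ i))"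
    proof (rule orthant_integral_combination_nonneg[OF G diag])
      fix x
      let ?m = "cross_term G i x"
      show "0 \<le> 1 * exp (- ?m\<^sup>2 / 2) + (- k + - k\<^sup>2 * ?m) * gauss_tail ?m"
        using inverse_mills_ratio_tangent[of ?m] by (simp add: k_def algebra_simps)
    qed
    also have "\<dots> = (a * k) * (y i - (1 + k\<^sup>2 * (y i - z i)))"
      unfolding J M a_def[symmetric] by (simp add: algebra_simps)
    finally have tangent: "1 + k\<^sup>2 * (y i - z i) \<le> y i"
      using mult_pos_pos[OF a k(1)] unfolding zero_le_mult_iff by linarith
    have "a\<^sup>2 * (k\<^sup>2 * (z i * y i)) \<le> a\<^sup>2 * 1"
      using orthant_mean_times_boundary_density_le[OF G diag]
      unfolding J M a_def[symmetric] by (simp add: power2_eq_square ac_simps)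
    then have prod: "k\<^sup>2 * (z i * y i) \<le> 1" using a by (simp only: mult_le_cancel_left_pos zero_less_power)
    show ?thesis
      unfolding beta using coordinate_inequality[OF k(2,3) tangent prod] by simp
  qed
  have t: "(\<Sum>i\<in>UNIV. 2 * z i - z i * y i) \<le> tval G"
  proof -
    let ?v = "\<chi> i. z i"
    have "(\<chi> j. orthant_integral G (\<lambda>x. x $ j)) = (a * k) *\<^sub>R ?v"
      by (simp add: vec_eq_iff M)
    then have "a * k * y i = a * k * (G *v ?v) $ i" for i
      using orthant_integral_gradient[OF G, of i] by (simp add: J matrix_vector_mult_scaleR)
    then have "(G *v ?v) $ i = y i" for i using a k by simp
    then show ?thesis
      using tval_variational[OF G, of ?v]
      by (simp add: inner_vec_def sum_distrib_right[symmetric] sum_subtractf mult.commute)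
  qed
  have main: "(2 + 4 / pi) * real CARD('n) + (\<Sum>i\<in>UNIV. D i) \<le> Psi G + 4 / pi * tval G"
  proof -
    have "(2 + 4 / pi) * real CARD('n) + (\<Sum>i\<in>UNIV. D i) = (\<Sum>i\<in>(UNIV :: 'n set). 2 + 2 * k\<^sup>2 + D i)"
      by (simp add: sum.distrib k(4) algebra_simps)
    also have "\<dots> \<le> (\<Sum>i\<in>UNIV. (\<integral>x. indicator (pos_except i) x * gauss_weight G x \<partial>lborel) / a
        + 2 * k\<^sup>2 * (2 * z i - z i * y i))"
      by (intro sum_mono coord)
    also have "\<dots> = Psi G + 2 * k\<^sup>2 * (\<Sum>i\<in>UNIV. 2 * z i - z i * y i)"
      by (simp add: sum.distrib Psi_eq[OF G] a_def sum_distrib_left)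
    also have "\<dots> \<le> Psi G + 4 / pi * tval G"
      using mult_left_mono[OF t, of "2 * k\<^sup>2"] k by simp
    finally show ?thesis .
  qed
  have nonneg: "0 \<le> (\<Sum>i\<in>UNIV. D i)" by (intro sum_nonneg D_nonneg)
  have rigid: "G = mat 1" if eq: "Psi G + 4 / pi * tval G = (2 + 4 / pi) * real CARD('n)"
  proof -
    have "(\<Sum>i\<in>UNIV. D i) = 0" using main eq nonneg by simp
    then have "D i = 0" for i using D_nonneg by (simp add: sum_nonneg_eq_0_iff)
    then have "G $ i $ j = 0" if "j \<noteq> i" for i j
      using row_trivial_if_coordinate_defect_zero[OF G that] a by (simp add: D_def)
    then show ?thesis using diag by (simp add: vec_eq_iff mat_def)
  qed
  have identity: "Psi G + 4 / pi * tval G = (2 + 4 / pi) * real CARD('n)" if "G = mat 1"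
    unfolding that Psi_mat_1 tval_mat_1 by (simp add: algebra_simps)
  show ?thesis
  proof (intro conjI iffI)
    show "(2 + 4 / pi) * real CARD('n) \<le> Psi G + 4 / pi * tval G" using main nonneg by linarith
  qed (fact rigid, fact identity)
qed

end
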